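(* Let $0<\rho,r<1$ satisfy $\rho+2r-\rho r\le 1$ and let $\{S_i\}_{i=1}^3$ be the IFS on $\mathbb R$ given by $$S_1(x)=\rho x,\qquad S_2(x)=rx+\rho(1-r),\qquad S_3(x)=rx+1-r.$$ Let $\mathbf p=(p_1,p_2,p_3)$ with $p_i>0$ and $p_1+p_2+p_3=1$, and let $\mu_{\mathbf p}$ be the associated self-similar measure. If $p_2>p_3$, then the $L^q$-spectrum $\tau(\mu_{\mathbf p},q)$ is differentiable at every $q\in\mathbb{R}$.
   Context: The self-similar measure $\mu_{\mathbf p}$ is the unique Borel probability measure on $\mathbb R$ with $\mu_{\mathbf p}(E)=\sum_{i=1}^3 p_i\mu_{\mathbf p}(S_i^{-1}(E))$ for all Borel $E$. The $L^q$-spectrum of a compactly supported finite Borel measure $\mu$ is $\tau(\mu,q)=\liminf_{t\downarrow0}\frac{\log\sup\sum_i\mu(B(x_i,t))^q}{\log t}$, $q\in\mathbb R$, where the supremum is over families of disjoint closed balls $\{B(x_i,t)\}_i$ of radius $t$ with centres $x_i\in\operatorname{supp}\mu$. *)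

theory Defs
  imports "HOL-Probability.Probability"
begin

text \<open>
  Being self-similar is a predicate on measures. For contractions and positive weights summing
  to one, Hutchinson's theorem says that exactly one measure satisfies it, so quantifying over
  all such measures is the same as speaking of ``the'' self-similar measure.
\<close>

definition self_similar_measure ::
    "'i set \<Rightarrow> ('i \<Rightarrow> real \<Rightarrow> real) \<Rightarrow> ('i \<Rightarrow> real) \<Rightarrow> real measure \<Rightarrow> bool" where
  "self_similar_measure I S p \<mu> \<longleftrightarrow>
     prob_space \<mu> \<and> sets \<mu> = sets borel \<and>
     (\<forall>E\<in>sets borel. measure \<mu> E = (\<Sum>i\<in>I. p i * measure \<mu> (S i -` E)))"

definition msupport :: "real measure \<Rightarrow> real set" where
  "msupport \<mu> = {x. \<forall>U. open U \<longrightarrow> x \<in> U \<longrightarrow> emeasure \<mu> U > 0}"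

text \<open>
  A family of pairwise disjoint closed balls of radius \<open>t > 0\<close> is determined by its set of
  centres. Centres of disjoint balls of radius \<open>t\<close> are more than \<open>t\<close> apart, so for a compactly
  supported measure only finite families occur.
\<close>

definition packings :: "real measure \<Rightarrow> real \<Rightarrow> real set set" where
  "packings \<mu> t = {X. finite X \<and> X \<subseteq> msupport \<mu> \<and> disjoint_family_on (\<lambda>x. cball x t) X}"

text \<open>
  The supremum is taken in the reals. Lemma \<open>bdd_above_moment_sums\<close> below shows
  that it is a genuine supremum for compactly supported finite Borel measures.
\<close>

definition moment_sum :: "real measure \<Rightarrow> real \<Rightarrow> real \<Rightarrow> real" where
  "moment_sum \<mu> q t = (SUP X\<in>packings \<mu> t. \<Sum>x\<in>X. measure \<mu> (cball x t) powr q)"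

definition Lq_spectrum :: "real measure \<Rightarrow> real \<Rightarrow> ereal" where
  "Lq_spectrum \<mu> q = Liminf (at_right 0) (\<lambda>t. ereal (ln (moment_sum \<mu> q t) / ln t))"

lemma bdd_above_moment_sums:
  assumes fin: "finite_measure \<mu>" and sets: "sets \<mu> = sets borel"
    and comp: "compact (msupport \<mu>)" and t: "t > 0"
  shows "bdd_above ((\<lambda>X. \<Sum>x\<in>X. measure \<mu> (cball x t) powr q) ` packings \<mu> t)"
proof -
  interpret finite_measure \<mu> by (fact fin)
  have "msupport \<mu> \<subseteq> (\<Union>x\<in>msupport \<mu>. ball x (t/2))"
    using t by force
  then obtain D where D: "D \<subseteq> msupport \<mu>" "finite D" "msupport \<mu> \<subseteq> (\<Union>x\<in>D. ball x (t/2))"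
    using compactE_image[OF comp, of "msupport \<mu>" "\<lambda>x. ball x (t/2)"] by blast
  define c where "c = Min (insert 1 ((\<lambda>x. measure \<mu> (ball x (t/2))) ` D))"
  have pos: "measure \<mu> (ball x (t/2)) > 0" if "x \<in> D" for x
  proof -
    have "emeasure \<mu> (ball x (t/2)) > 0"
      using that D(1) t by (auto simp: msupport_def)
    then show ?thesis
      by (simp add: emeasure_eq_measure)
  qed
  have c: "c > 0"
    unfolding c_def using D(2) pos by (subst Min_gr_iff) auto
  define M where "M = measure \<mu> (space \<mu>)"
  define B where "B = c powr q + M powr q"
  have term_le: "measure \<mu> (cball x t) powr q \<le> B" if x: "x \<in> msupport \<mu>" for x
  proof -
    obtain d where d: "d \<in> D" "x \<in> ball d (t/2)"
      using D(3) x by blast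
    have sub: "ball d (t/2) \<subseteq> cball x t"
    proof
      fix y assume "y \<in> ball d (t/2)"
      then show "y \<in> cball x t"
        using d(2) unfolding mem_ball mem_cball dist_real_def by (smt (verit) field_sum_of_halves)
    qed
    have "c \<le> measure \<mu> (ball d (t/2))"
      unfolding c_def using d(1) D(2) by (intro Min_le) auto
    also have "\<dots> \<le> measure \<mu> (cball x t)"
      using sub by (intro finite_measure_mono) (auto simp: sets)
    finally have lo: "c \<le> measure \<mu> (cball x t)" .
    have hi: "measure \<mu> (cball x t) \<le> M"
      unfolding M_def by (rule bounded_measure)
    show ?thesis
    proof (cases "q \<ge> 0")
      case True
      then have "measure \<mu> (cball x t) powr q \<le> M powr q"
        using hi by (intro powr_mono2) auto
      then show ?thesis by (simp add: B_def add_increasing)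
    next
      case False
      then have "measure \<mu> (cball x t) powr q \<le> c powr q"
        using lo c by (intro powr_mono2') auto
      then show ?thesis by (simp add: B_def add_increasing2)
    qed
  qed
  have "(\<Sum>x\<in>X. measure \<mu> (cball x t) powr q) \<le> real (card D) * B" if X: "X \<in> packings \<mu> t" for X
  proof -
    have XD: "X \<subseteq> msupport \<mu>" "finite X" "disjoint_family_on (\<lambda>x. cball x t) X"
      using X by (auto simp: packings_def)
    have "\<forall>x\<in>X. \<exists>d\<in>D. x \<in> ball d (t/2)"
      using XD(1) D(3) by blast
    then obtain f where f: "\<And>x. x \<in> X \<Longrightarrow> f x \<in> D \<and> x \<in> ball (f x) (t/2)"
      by metis
    have "inj_on f X"
    proof (rule inj_onI, rule ccontr)
      fix x y assume xy: "x \<in> X" "y \<in> X" "f x = f y" "x \<noteq> y"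
      have "y \<in> cball x t"
        using f[OF xy(1)] f[OF xy(2)] xy(3) unfolding mem_ball mem_cball dist_real_def by (smt (verit) field_sum_of_halves)
      moreover have "y \<in> cball y t" using t by simp
      ultimately show False
        using XD(3) xy unfolding disjoint_family_on_def by blast
    qed
    then have "card X \<le> card D"
      using f D(2) by (intro card_inj_on_le) auto
    moreover have "B \<ge> 0" by (simp add: B_def)
    moreover have "(\<Sum>x\<in>X. measure \<mu> (cball x t) powr q) \<le> real (card X) * B"
      using XD(1) term_le by (intro sum_bounded_above) auto
    ultimately show ?thesis
      by (meson mult_right_mono of_nat_mono order_trans)
  qed
  then show ?thesis by (intro bdd_aboveI) auto
qed

end

theory Submission
  imports Defs
begin

text \<open>
  The only overlap comes from \<open>S1 \<circ> S3 = S2 \<circ> S1\<close>. Rewriting 13 to 21 shows that words without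
  the factor 13 code non-overlapping cells, and that such a word has the product of the total
  weights \<open>p1 * (\<Sum>a+b=k. p2^a * p3^b)\<close> of its blocks \<open>2^k 1\<close> as a factor of its measure. Since
  \<open>p3 < p2\<close>, this block weight is comparable to \<open>p2^k\<close> uniformly in \<open>k\<close>, so the countable system of
  blocks has, for every \<open>q\<close>, a unique exponent \<open>\<tau>\<close> of spectral radius 1 inside its domain of
  convergence. The eigenvector yields an energy comparable to \<open>\<mu>(cell)^q * diam(cell)^(-\<tau>)\<close> that
  is additive under subdivision, and summing over cells of size about \<open>t\<close> shows that the moment sums
  are comparable to \<open>t^\<tau>\<close>. Finally \<open>\<tau>(q)\<close> is a level set of a series of exponentials of linear
  functions in \<open>(q, \<tau>)\<close> that converges in a neighbourhood, hence differentiable.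
\<close>

section \<open>Level sets of sums of exponentials\<close>

text \<open>The obstacle is that the measure on the image of \<open>J\<close> under
  \<open>S2\<close> is not a scaled copy of \<open>\<mu>\<close> but mixes one with a part inherited
  through the overlap, in proportions that change with the length of the pending run of twos. Blocks
  of every length are therefore treated as separate symbols. The ratio of the block weight to
  \<open>p2 ^ k\<close> is a partial sum of a geometric series of ratio \<open>p3 / p2\<close>;
  \<open>p3 < p2\<close> bounds it, whereas for \<open>p3 = p2\<close> it would grow linearly in
  \<open>k\<close>. A countable system may have its critical exponent on the boundary of the domain
  of convergence, where smoothness can fail. Here this is excluded by the product of the geometric
  series for the letters 2 and 3, which diverges at the boundary. Both signs of \<open>q\<close>
  have to be served. For negative \<open>q\<close> a ball of small mass is the danger, so balls are
  compared with cells from above and from below.\<close>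

lemma exp_le_quadratic:
  fixes u :: real
  shows "exp u \<le> 1 + u + u\<^sup>2 * exp \<bar>u\<bar>"
proof -
  obtain t where t: "\<bar>t\<bar> \<le> \<bar>u\<bar>" "exp u = (\<Sum>m<2. u ^ m / fact m) + exp t / fact 2 * u ^ 2"
    using Maclaurin_exp_le[of u 2] by blast
  have "exp t \<le> exp \<bar>u\<bar>"
    using t(1) by simp
  then have "exp t / 2 \<le> exp \<bar>u\<bar>"
    by (smt (verit) exp_gt_zero field_sum_of_halves)
  then have "exp t / 2 * u\<^sup>2 \<le> exp \<bar>u\<bar> * u\<^sup>2"
    by (intro mult_right_mono) auto
  then show ?thesis
    using t(2) by (simp add: numeral_2_eq_2 mult.commute)
qed

lemma has_real_derivative_if_quadratic_error:
  fixes f :: "real \<Rightarrow> real"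
  assumes "e > 0" and bound: "\<And>h. \<bar>h\<bar> < e \<Longrightarrow> \<bar>f (x + h) - f x - D * h\<bar> \<le> M * h\<^sup>2"
  shows "(f has_real_derivative D) (at x)"
proof -
  have "((\<lambda>h. (f (x + h) - f x) / h - D) \<longlongrightarrow> 0) (at 0)"
  proof (rule Lim_null_comparison)
    show "\<forall>\<^sub>F h in at 0. norm ((f (x + h) - f x) / h - D) \<le> M * \<bar>h\<bar>"
      unfolding eventually_at
    proof (intro exI[of _ e] conjI ballI impI)
      fix h :: real assume h: "h \<noteq> 0 \<and> dist h 0 < e"
      have "\<bar>f (x + h) - f x - D * h\<bar> \<le> (M * \<bar>h\<bar>) * \<bar>h\<bar>"
        using bound[of h] h by (simp add: power2_eq_square mult.assoc)
      moreover have "(f (x + h) - f x) / h - D = (f (x + h) - f x - D * h) / h"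
        using h by (simp add: field_simps)
      ultimately show "norm ((f (x + h) - f x) / h - D) \<le> M * \<bar>h\<bar>"
        using h by (simp add: abs_divide pos_divide_le_eq)
    qed (use assms in auto)
    show "((\<lambda>h. M * \<bar>h\<bar>) \<longlongrightarrow> 0) (at 0)"
      by (auto intro!: tendsto_eq_intros)
  qed
  then show ?thesis
    unfolding DERIV_def by (rule LIM_zero_cancel)
qed

text \<open>
  Convexity of the exponential puts \<open>\<tau>\<close> below its tangent line; the quadratic upper bound for
  \<open>exp\<close> puts it above a parabola with the same tangent.
\<close>

lemma exponential_sum_level_set_differentiable:
  fixes A B :: "'e \<Rightarrow> real" and \<tau> :: "real \<Rightarrow> real"
  assumes A: "\<And>e. A e \<le> 0" and B: "\<And>e. 0 < B e"
    and one: "\<And>q. ((\<lambda>e. exp (q * A e + \<tau> q * B e)) has_sum 1) UNIV"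
    and ext: "\<And>q. \<exists>\<delta>>0. (\<lambda>e. exp ((q - \<delta>) * A e + (\<tau> q + \<delta>) * B e)) summable_on UNIV"
  shows "\<tau> differentiable (at q)"
proof -
  obtain \<delta> where \<delta>: "\<delta> > 0" "(\<lambda>e. exp ((q - \<delta>) * A e + (\<tau> q + \<delta>) * B e)) summable_on UNIV"
    using ext by blast
  define w where "w e = exp (q * A e + \<tau> q * B e)" for e
  \<comment> \<open>Moving from \<open>(q, \<tau> q)\<close> by \<open>\<delta>\<close> in direction
    (-1, 1) multiplies the term \<open>w e\<close> by \<open>exp (\<delta> * L e)\<close>. By the
    signs of \<open>A\<close> and \<open>B\<close>, \<open>L\<close> also dominates both, so this
    one margin of convergence controls every sum below.\<close>
  define L where "L e = B e - A e" for e
  have L: "L e > 0" "\<bar>A e\<bar> \<le> L e" "\<bar>B e\<bar> \<le> L e" for e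
    using A[of e] B[of e] by (auto simp: L_def)
  have w: "w e > 0" for e by (simp add: w_def)
  have w1: "(w has_sum 1) UNIV" using one[of q] by (simp add: w_def[abs_def])
  have wL: "(\<lambda>e. w e * exp (\<delta> * L e)) summable_on UNIV"
    using \<delta>(2) by (simp add: w_def L_def algebra_simps flip: exp_add)
  have sumL: "(\<lambda>e. w e * L e) summable_on UNIV"
  proof (rule summable_on_comparison_test)
    show "(\<lambda>e. 1 / \<delta> * (w e * exp (\<delta> * L e))) summable_on UNIV"
      by (intro summable_on_cmult_right wL)
    fix e
    have "\<delta> * L e \<le> exp (\<delta> * L e)" using exp_ge_add_one_self[of "\<delta> * L e"] by linarith
    then have "w e * (\<delta> * L e) \<le> w e * exp (\<delta> * L e)"
      by (intro mult_left_mono) (auto simp: w less_imp_le)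
    then show "w e * L e \<le> 1 / \<delta> * (w e * exp (\<delta> * L e))"
      using \<delta>(1) by (simp add: field_simps)
    show "0 \<le> w e * L e" using w L by (simp add: less_imp_le)
  qed
  \<comment> \<open>Half of the margin \<open>\<delta>\<close> absorbs the square of
    \<open>L\<close>, by squaring \<open>\<delta> / 4 * L e \<le> exp (\<delta> / 4 * L e)\<close>,
    whence the constant 16. The other half stays for the error term of the exponential.\<close>
  have sumL2: "(\<lambda>e. w e * ((L e)\<^sup>2 * exp (\<delta> / 2 * L e))) summable_on UNIV"
  proof (rule summable_on_comparison_test)
    show "(\<lambda>e. 16 / \<delta>\<^sup>2 * (w e * exp (\<delta> * L e))) summable_on UNIV"
      by (intro summable_on_cmult_right wL)
    fix e
    have "\<delta> / 4 * L e \<le> exp (\<delta> / 4 * L e)" using exp_ge_add_one_self[of "\<delta> / 4 * L e"] by linarith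
    then have "(\<delta> / 4 * L e)\<^sup>2 \<le> (exp (\<delta> / 4 * L e))\<^sup>2"
      using \<delta> L by (intro power_mono) (auto simp: less_imp_le)
    also have "\<dots> = exp (\<delta> / 2 * L e)" by (simp flip: exp_double)
    finally have "(L e)\<^sup>2 \<le> 16 / \<delta>\<^sup>2 * exp (\<delta> / 2 * L e)"
      using \<delta> by (simp add: field_simps power2_eq_square)
    then have "(L e)\<^sup>2 * exp (\<delta> / 2 * L e) \<le> 16 / \<delta>\<^sup>2 * exp (\<delta> / 2 * L e) * exp (\<delta> / 2 * L e)"
      by (intro mult_right_mono) auto
    also have "\<dots> = 16 / \<delta>\<^sup>2 * exp (\<delta> * L e)"
      by (simp add: mult.assoc flip: exp_add)
    finally have "w e * ((L e)\<^sup>2 * exp (\<delta> / 2 * L e)) \<le> w e * (16 / \<delta>\<^sup>2 * exp (\<delta> * L e))"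
      using w[of e] by (intro mult_left_mono) auto
    then show "w e * ((L e)\<^sup>2 * exp (\<delta> / 2 * L e)) \<le> 16 / \<delta>\<^sup>2 * (w e * exp (\<delta> * L e))"
      by (simp only: mult.left_commute)
    show "0 \<le> w e * ((L e)\<^sup>2 * exp (\<delta> / 2 * L e))" using w[of e] by simp
  qed
  define K where "K = (\<Sum>\<^sub>\<infinity>e. w e * ((L e)\<^sup>2 * exp (\<delta> / 2 * L e)))"
  have hK: "((\<lambda>e. w e * ((L e)\<^sup>2 * exp (\<delta> / 2 * L e))) has_sum K) UNIV"
    unfolding K_def by (rule has_sum_infsum[OF sumL2])
  have hB: "(\<lambda>e. w e * B e) summable_on UNIV"
  proof (rule summable_on_comparison_test[OF sumL])
    fix e
    show "w e * B e \<le> w e * L e" using w[of e] A[of e] by (simp add: L_def)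
    show "0 \<le> w e * B e" using w[of e] B[of e] by simp
  qed
  have "(\<lambda>e. w e * (- A e)) summable_on UNIV"
  proof (rule summable_on_comparison_test[OF sumL])
    fix e
    show "w e * (- A e) \<le> w e * L e" using w[of e] B[of e] by (intro mult_left_mono) (auto simp: L_def)
    show "0 \<le> w e * (- A e)" using w[of e] A[of e] by (intro mult_nonneg_nonneg) auto
  qed
  then have hA: "(\<lambda>e. w e * A e) summable_on UNIV"
    using summable_on_uminus[of "\<lambda>e. w e * (- A e)" UNIV] by simp
  define \<alpha> where "\<alpha> = (\<Sum>\<^sub>\<infinity>e. w e * A e)"
  define \<beta> where "\<beta> = (\<Sum>\<^sub>\<infinity>e. w e * B e)"
  have h\<alpha>: "((\<lambda>e. w e * A e) has_sum \<alpha>) UNIV" unfolding \<alpha>_def by (rule has_sum_infsum[OF hA])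
  have h\<beta>: "((\<lambda>e. w e * B e) has_sum \<beta>) UNIV" unfolding \<beta>_def by (rule has_sum_infsum[OF hB])
  have lin: "((\<lambda>e. w e * (1 + (d * A e + t * B e))) has_sum 1 + (d * \<alpha> + t * \<beta>)) UNIV" for d t
  proof -
    have "((\<lambda>e. w e + (d * (w e * A e) + t * (w e * B e))) has_sum 1 + (d * \<alpha> + t * \<beta>)) UNIV"
      by (intro has_sum_add has_sum_cmult_right w1 h\<alpha> h\<beta>)
    then show ?thesis by (simp add: algebra_simps)
  qed
  have \<beta>: "\<beta> > 0"
  proof (rule ccontr)
    assume "\<not> \<beta> > 0"
    then have "w e * B e = 0" for e
      using w B by (intro nonneg_has_sum_le_0D[OF h\<beta>]) (auto simp: less_imp_le)
    moreover have "w e * B e > 0" for e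
      using w B by (intro mult_pos_pos)
    ultimately show False by (metis less_irrefl)
  qed
  have K: "K \<ge> 0"
    unfolding K_def using w by (intro infsum_nonneg) (auto simp: less_imp_le)
  \<comment> \<open>The slope given by implicit differentiation of the equation that the terms sum
    to 1: \<open>\<alpha> + \<sigma> * \<beta> = 0\<close>.\<close>
  define \<sigma> where "\<sigma> = - \<alpha> / \<beta>"
  have \<sigma>: "d * \<alpha> + t * \<beta> = \<beta> * (t - \<sigma> * d)" for d t
    using \<beta> by (simp add: \<sigma>_def field_simps)
  have shift: "exp (q' * A e + t * B e) = w e * exp ((q' - q) * A e + (t - \<tau> q) * B e)" for q' t e
    by (simp add: w_def algebra_simps flip: exp_add)
  \<comment> \<open>Termwise \<open>1 + u \<le> exp u\<close>, where the right-hand terms again sum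
    to 1.\<close>
  have upper: "\<tau> q' - \<tau> q \<le> \<sigma> * (q' - q)" for q'
  proof -
    have "1 + ((q' - q) * \<alpha> + (\<tau> q' - \<tau> q) * \<beta>) \<le> 1"
    proof (rule has_sum_mono[OF lin one[of q']])
      fix e
      show "w e * (1 + ((q' - q) * A e + (\<tau> q' - \<tau> q) * B e)) \<le> exp (q' * A e + \<tau> q' * B e)"
        using w by (subst shift, intro mult_left_mono exp_ge_add_one_self) (auto simp: less_imp_le)
    qed
    then have "\<beta> * (\<tau> q' - \<tau> q - \<sigma> * (q' - q)) \<le> 0" unfolding \<sigma> by linarith
    then show ?thesis using \<beta> by (simp add: mult_le_0_iff)
  qed
  \<comment> \<open>\<open>M\<close> solves \<open>\<beta> * M = s\<^sup>2 * K + 1\<close>: bending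
    down by \<open>M * h\<^sup>2\<close> pays for the quadratic error and leaves
    \<open>h\<^sup>2\<close> to spare, so the majorant sums to \<open>1 - h\<^sup>2\<close>. The two
    entries of \<open>\<epsilon>\<close> ensure \<open>\<bar>t\<bar> \<le> s * \<bar>h\<bar>\<close>
    and \<open>\<bar>u\<bar> \<le> \<delta> / 2 * L e\<close>.\<close>
  define s where "s = \<bar>\<sigma>\<bar> + 1"
  define M where "M = (s\<^sup>2 * K + 1) / \<beta>"
  have s: "s \<ge> 1" "s > 0" and M: "M > 0" using K \<beta> by (auto simp: s_def M_def intro!: divide_pos_pos add_nonneg_pos)
  define \<epsilon> where "\<epsilon> = min (1 / M) (\<delta> / (2 * s))"
  have \<epsilon>: "\<epsilon> > 0" using M \<delta> s by (simp add: \<epsilon>_def)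
  have lower: "\<tau> (q + h) - \<tau> q \<ge> \<sigma> * h - M * h\<^sup>2" if h: "\<bar>h\<bar> < \<epsilon>" for h
  proof (cases "h = 0")
    case False
    define t where "t = \<sigma> * h - M * h\<^sup>2"
    have "M * \<bar>h\<bar> < 1" using h M by (simp add: \<epsilon>_def field_simps)
    then have "M * h\<^sup>2 \<le> \<bar>h\<bar>"
      using mult_right_mono[of "M * \<bar>h\<bar>" 1 "\<bar>h\<bar>"] by (simp add: power2_eq_square)
    moreover have "M * h\<^sup>2 \<ge> 0" using M by simp
    ultimately have "\<bar>t\<bar> \<le> \<bar>\<sigma> * h\<bar> + \<bar>h\<bar>" unfolding t_def by linarith
    then have t: "\<bar>t\<bar> \<le> s * \<bar>h\<bar>" by (simp add: s_def abs_mult algebra_simps)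
    have hs: "\<bar>h\<bar> \<le> s * \<bar>h\<bar>" using s mult_right_mono[of 1 s "\<bar>h\<bar>"] by simp
    have sh: "s * \<bar>h\<bar> \<le> \<delta> / 2" using h s by (simp add: \<epsilon>_def field_simps)
    have term_le: "exp ((q + h) * A e + (\<tau> q + t) * B e)
      \<le> w e * (1 + (h * A e + t * B e)) + (s * h)\<^sup>2 * (w e * ((L e)\<^sup>2 * exp (\<delta> / 2 * L e)))" for e
    proof -
      define u where "u = h * A e + t * B e"
      have "\<bar>u\<bar> \<le> \<bar>h\<bar> * \<bar>A e\<bar> + \<bar>t\<bar> * \<bar>B e\<bar>"
        unfolding u_def by (metis abs_mult abs_triangle_ineq)
      also have "\<dots> \<le> s * \<bar>h\<bar> * \<bar>A e\<bar> + s * \<bar>h\<bar> * \<bar>B e\<bar>"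
        using hs t by (intro add_mono mult_right_mono) auto
      also have "\<dots> = s * \<bar>h\<bar> * L e" using A[of e] B[of e] by (simp add: L_def algebra_simps)
      finally have u: "\<bar>u\<bar> \<le> s * \<bar>h\<bar> * L e" .
      then have "u\<^sup>2 \<le> (s * \<bar>h\<bar> * L e)\<^sup>2" by (metis abs_ge_zero power2_abs power_mono)
      then have u2: "u\<^sup>2 \<le> (s * h)\<^sup>2 * (L e)\<^sup>2" by (simp add: power_mult_distrib)
      have "\<bar>u\<bar> \<le> \<delta> / 2 * L e"
        using u mult_right_mono[OF sh, of "L e"] L(1)[of e] by linarith
      then have "u\<^sup>2 * exp \<bar>u\<bar> \<le> ((s * h)\<^sup>2 * (L e)\<^sup>2) * exp (\<delta> / 2 * L e)"
        using u2 by (intro mult_mono) auto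
      then have "exp u \<le> 1 + u + (s * h)\<^sup>2 * ((L e)\<^sup>2 * exp (\<delta> / 2 * L e))"
        using exp_le_quadratic[of u] by (simp add: mult.assoc)
      then have "w e * exp u \<le> w e * (1 + u + (s * h)\<^sup>2 * ((L e)\<^sup>2 * exp (\<delta> / 2 * L e)))"
        using w by (intro mult_left_mono) (auto simp: less_imp_le)
      then show ?thesis
        by (subst shift) (simp add: u_def algebra_simps)
    qed
    have major: "((\<lambda>e. w e * (1 + (h * A e + t * B e)) + (s * h)\<^sup>2 * (w e * ((L e)\<^sup>2 * exp (\<delta> / 2 * L e))))
      has_sum 1 + (h * \<alpha> + t * \<beta>) + (s * h)\<^sup>2 * K) UNIV"
      by (intro has_sum_add has_sum_cmult_right lin hK)
    have "h * \<alpha> + t * \<beta> = - (\<beta> * M) * h\<^sup>2" unfolding \<sigma> by (simp add: t_def)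
    also have "\<dots> = - (s\<^sup>2 * K + 1) * h\<^sup>2" using \<beta> by (simp add: M_def)
    finally have eq: "1 + (h * \<alpha> + t * \<beta>) + (s * h)\<^sup>2 * K = 1 - h\<^sup>2"
      by (simp add: algebra_simps power_mult_distrib)
    show ?thesis
    proof (rule ccontr)
      assume "\<not> ?thesis"
      then have less: "\<tau> (q + h) < \<tau> q + t" by (simp add: t_def)
      have "1 \<le> 1 + (h * \<alpha> + t * \<beta>) + (s * h)\<^sup>2 * K"
      proof (rule has_sum_mono[OF one[of "q + h"] major])
        fix e
        have "\<tau> (q + h) * B e \<le> (\<tau> q + t) * B e"
          using less B[of e] by (intro mult_right_mono) auto
        then show "exp ((q + h) * A e + \<tau> (q + h) * B e)
          \<le> w e * (1 + (h * A e + t * B e)) + (s * h)\<^sup>2 * (w e * ((L e)\<^sup>2 * exp (\<delta> / 2 * L e)))"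
          by (intro order_trans[OF _ term_le]) simp
      qed
      then show False using False eq by simp
    qed
  qed simp
  have "(\<tau> has_real_derivative \<sigma>) (at q)"
  proof (rule has_real_derivative_if_quadratic_error[OF \<epsilon>])
    fix h :: real assume "\<bar>h\<bar> < \<epsilon>"
    then show "\<bar>\<tau> (q + h) - \<tau> q - \<sigma> * h\<bar> \<le> M * h\<^sup>2"
      using lower[of h] upper[of "q + h"] M zero_le_power2[of h]
      by (smt (verit) add_diff_cancel_left' mult_nonneg_nonneg)
  qed
  then show ?thesis
    using real_differentiable_def by blast
qed

section \<open>The critical exponent\<close>

text \<open>The direction in which \<open>u powr q\<close> is monotone depends on the sign of
  \<open>q\<close>. Taking the smaller and the larger endpoint value keeps later comparisons uniform
  in \<open>q\<close>.\<close>

lemma powr_between: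
  fixes a b u q :: real
  assumes "0 < a" "a \<le> u" "u \<le> b"
  shows "min (a powr q) (b powr q) \<le> u powr q" "u powr q \<le> max (a powr q) (b powr q)"
proof -
  have "a powr q \<le> u powr q \<and> u powr q \<le> b powr q \<or> b powr q \<le> u powr q \<and> u powr q \<le> a powr q"
  proof (cases "q \<ge> 0")
    case True
    then show ?thesis using assms by (intro disjI1 conjI powr_mono2) auto
  next
    case False
    then show ?thesis using assms by (intro disjI2 conjI powr_mono2') auto
  qed
  then show "min (a powr q) (b powr q) \<le> u powr q" "u powr q \<le> max (a powr q) (b powr q)"
    by auto
qed

text \<open>
  \<open>block_weight p1 p2 p3 k\<close> is \<open>\<Sum>a+b=k. p2^a * p1 * p3^b\<close>, the total weight of the words
  \<open>2^a 1 3^b\<close>, all of which denote the same map as \<open>2^k 1\<close>.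
\<close>

primrec block_weight :: "real \<Rightarrow> real \<Rightarrow> real \<Rightarrow> nat \<Rightarrow> real" where
  "block_weight p1 p2 p3 0 = p1"
| "block_weight p1 p2 p3 (Suc k) = p1 * p2 ^ Suc k + p3 * block_weight p1 p2 p3 k"

locale overlap_weights =
  fixes \<rho> r p1 p2 p3 :: real
  assumes \<rho>: "0 < \<rho>" "\<rho> < 1" and r: "0 < r" "r < 1"
    and p_pos: "0 < p1" "0 < p2" "0 < p3" and p_sum: "p1 + p2 + p3 = 1"
    and p3_less: "p3 < p2"
begin

abbreviation P :: "nat \<Rightarrow> real" where "P \<equiv> block_weight p1 p2 p3"

text \<open>The value of the series of \<open>p1 * (p3 / p2) ^ b\<close> over all \<open>b\<close>,
  of which \<open>P k / p2 ^ k\<close> is a partial sum. The hypothesis \<open>p3 < p2\<close>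
  enters through this constant.\<close>

definition \<kappa> :: real where "\<kappa> = p1 * p2 / (p2 - p3)"

lemma P_lower: "p1 * p2 ^ k \<le> P k"
proof (induction k)
  case (Suc k)
  moreover have "0 \<le> p1 * p2 ^ k" using p_pos by simp
  ultimately have "0 \<le> P k" by linarith
  then have "0 \<le> p3 * P k" using p_pos by simp
  then show ?case by simp
qed simp

lemma P_pos [simp]: "0 < P k"
  using P_lower[of k] p_pos by (smt (verit) mult_pos_pos zero_less_power)

lemma P_upper: "P k \<le> \<kappa> * p2 ^ k"
proof (induction k)
  case 0
  have "p1 * (p2 - p3) \<le> p1 * p2" using p_pos by simp
  then show ?case using p3_less by (simp add: \<kappa>_def pos_le_divide_eq)
next
  case (Suc k)
  have \<kappa>: "\<kappa> * p2 = p1 * p2 + p3 * \<kappa>" using p3_less by (simp add: \<kappa>_def field_simps)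
  have "P (Suc k) \<le> p1 * p2 ^ Suc k + p3 * (\<kappa> * p2 ^ k)"
    using Suc p_pos by (simp add: mult_left_mono)
  also have "\<dots> = (p1 * p2 + p3 * \<kappa>) * p2 ^ k" by (simp add: algebra_simps)
  also have "\<dots> = \<kappa> * p2 ^ Suc k" by (simp flip: \<kappa>)
  finally show ?case .
qed

lemma P_le_1: "P k \<le> 1"
proof (induction k)
  case (Suc k)
  have "p1 * p2 ^ Suc k \<le> p1 * 1" using p_pos p_sum by (intro mult_left_mono power_le_one) auto
  moreover have "p3 * P k \<le> p3 * 1" using Suc p_pos by (intro mult_left_mono) auto
  ultimately have "P (Suc k) \<le> p1 + p3" by (simp only: block_weight.simps)
  then show ?case using p_pos p_sum by linarith
qed (use p_pos p_sum in auto)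

definition c_lo :: "real \<Rightarrow> real" where "c_lo q = min (p1 powr q) (\<kappa> powr q)"
definition c_hi :: "real \<Rightarrow> real" where "c_hi q = max (p1 powr q) (\<kappa> powr q)"

lemma \<kappa>_pos: "\<kappa> > 0"
  using p_pos p3_less by (simp add: \<kappa>_def)

lemma c_lo_pos: "c_lo q > 0"
  using p_pos \<kappa>_pos by (simp add: c_lo_def)

lemma c_hi_pos: "c_hi q > 0"
  using p_pos \<kappa>_pos by (simp add: c_hi_def less_max_iff_disj)

lemma P_ratio_powr: "c_lo q \<le> (P k / p2 ^ k) powr q" "(P k / p2 ^ k) powr q \<le> c_hi q"
  unfolding c_lo_def c_hi_def using P_lower P_upper p_pos
  by (auto intro!: powr_between simp: pos_le_divide_eq pos_divide_le_eq)

text \<open>The terms of the letters 2 and 3 in the classical equation that the sum of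
  \<open>p_i powr q * r_i powr (- t)\<close> is 1, which gives the spectrum of a system without
  overlaps. \<open>block_term\<close> is the corresponding term of the collapsed block
  \<open>2^k 1\<close>.\<close>

definition X :: "real \<Rightarrow> real \<Rightarrow> real" where "X q t = p2 powr q * r powr (- t)"
definition Y :: "real \<Rightarrow> real \<Rightarrow> real" where "Y q t = p3 powr q * r powr (- t)"
definition block_term :: "real \<Rightarrow> real \<Rightarrow> nat \<Rightarrow> real" where
  "block_term q t k = P k powr q * (\<rho> * r ^ k) powr (- t)"

lemma XY_pos [simp]: "X q t > 0" "Y q t > 0"
  using p_pos r by (auto simp: X_def Y_def)

lemma block_term_pos [simp]: "block_term q t k > 0"
  using \<rho> r by (simp add: block_term_def less_imp_neq[THEN not_sym])

lemma X_power: "X q t ^ k = (p2 ^ k) powr q * (r ^ k) powr (- t)"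
proof -
  have "(p2 powr q) ^ k = (p2 ^ k) powr q" "(r powr (- t)) ^ k = (r ^ k) powr (- t)"
    by (induction k) (use p_pos r in \<open>auto simp: powr_mult\<close>)
  then show ?thesis by (simp add: X_def power_mult_distrib)
qed

text \<open>Splitting off the bounded ratio \<open>P k / p2 ^ k\<close> leaves a power series in
  \<open>X\<close>, from which both convergence and continuity are read off.\<close>

lemma block_term_eq: "block_term q t k = \<rho> powr (- t) * ((P k / p2 ^ k) powr q * X q t ^ k)"
proof -
  have "P k powr q = (P k / p2 ^ k) powr q * (p2 ^ k) powr q"
    using p_pos by (simp add: powr_divide less_imp_le)
  then show ?thesis
    using \<rho> r by (simp add: block_term_def X_power powr_mult)
qed

lemma summable_ratio_powr:
  assumes "\<bar>x\<bar> < 1"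
  shows "summable (\<lambda>k. (P k / p2 ^ k) powr q * x ^ k)"
proof (rule summable_comparison_test')
  show "summable (\<lambda>k. c_hi q * \<bar>x\<bar> ^ k)"
    using assms by (intro summable_mult summable_geometric) auto
  show "norm ((P k / p2 ^ k) powr q * x ^ k) \<le> c_hi q * \<bar>x\<bar> ^ k" for k
    using P_ratio_powr by (simp add: abs_mult power_abs mult_right_mono)
qed

lemma summable_block_term: "X q t < 1 \<Longrightarrow> summable (block_term q t)"
  unfolding block_term_eq[abs_def]
  by (intro summable_mult summable_ratio_powr) (simp add: less_imp_le)

text \<open>
  The infinite graph-directed system on the vertices \<open>A\<close> (empty word or last letter 3) and \<open>B\<close>
  (last letter 1) has edges \<open>2^k 1\<close> and \<open>2^k 3\<close>, where \<open>k > 0\<close> for edges \<open>2^k 3\<close> leaving \<open>B\<close>.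
  Writing \<open>Z\<close> for the sum of the block terms, its matrix \<open>((Y/(1-X), Z), (XY/(1-X), Z))\<close> has
  eigenvalue 1 iff \<open>Z (1-X) (1-Y) = 1 - X - Y\<close>. In the form below all terms are exponentials.
\<close>

definition pressure :: "real \<Rightarrow> real \<Rightarrow> real" where
  "pressure q t = (\<Sum>k. block_term q t k) + X q t / (1 - X q t) * (Y q t / (1 - Y q t))"

text \<open>The substitution \<open>z = r powr (- t)\<close> makes \<open>X\<close> and
  \<open>Y\<close> linear in \<open>z\<close>, and the intermediate value theorem applies on an
  interval ending just before the first of the poles \<open>X = 1\<close> and
  \<open>Y = 1\<close>.\<close>

lemma ex_critical_exponent:
  "\<exists>t. X q t < 1 \<and> Y q t < 1 \<and> pressure q t = 1"
proof -
  \<comment> \<open>So \<open>\<rho> = r powr \<gamma>\<close>, and \<open>\<rho> powr (- t)\<close>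
    becomes \<open>z powr \<gamma>\<close>.\<close>
  define \<gamma> where "\<gamma> = ln \<rho> / ln r"
  define a where "a = p2 powr q"
  define b where "b = p3 powr q"
  define S where "S x = (\<Sum>k. (P k / p2 ^ k) powr q * x ^ k)" for x :: real
  define f where "f z = z powr \<gamma> * S (a * z) + a * z / (1 - a * z) * (b * z / (1 - b * z))" for z
  define z0 where "z0 = min (1 / a) (1 / b)"
  \<comment> \<open>\<open>f z - 1\<close> with \<open>S\<close> replaced by its geometric lower
    bound, cleared of the denominators. Unlike \<open>f\<close> it is continuous at the pole
    \<open>z0\<close>. There the subtracted product vanishes, so \<open>g\<close> is positive at
    \<open>z0\<close> and hence slightly to its left.\<close>
  define g where "g z = c_lo q * z powr \<gamma> * (1 - b * z) + a * z * (b * z) - (1 - a * z) * (1 - b * z)" for z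
  have \<gamma>: "\<gamma> > 0" using \<rho> r by (simp add: \<gamma>_def divide_neg_neg)
  have ab: "a > 0" "b > 0" using p_pos by (auto simp: a_def b_def)
  have z0: "z0 > 0" "a * z0 \<le> 1" "b * z0 \<le> 1" "a * z0 = 1 \<or> b * z0 = 1"
    using ab by (auto simp: z0_def min_def field_simps)
  have less1: "a * z < 1" "b * z < 1" if "z < z0" for z
    using that ab z0 mult_strict_left_mono[of z z0 a] mult_strict_left_mono[of z z0 b] by linarith+
  have "g z0 > 0"
  proof (cases "b * z0 = 1")
    case True
    then show ?thesis using ab z0 by (simp add: g_def)
  next
    case False
    then have "a * z0 = 1" "b * z0 < 1" using z0 by auto
    then show ?thesis using ab z0 c_lo_pos[of q]
      by (auto simp: g_def intro!: add_nonneg_pos mult_nonneg_nonneg)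
  qed
  moreover have "isCont g z0"
    unfolding g_def using z0 by (intro continuous_intros) auto
  ultimately have "\<forall>\<^sub>F z in at_left z0. g z > 0"
    by (metis at_le filterlim_mono isCont_def le_refl order_refl order_tendstoD(1) top_greatest)
  then obtain l where l: "l < z0" "\<And>z. l < z \<Longrightarrow> z < z0 \<Longrightarrow> g z > 0"
    unfolding eventually_at_left_field by auto
  define z1 where "z1 = (max l 0 + z0) / 2"
  have z1: "0 < z1" "z1 < z0" "g z1 > 0"
    using l z0 by (auto simp: z1_def max_def field_simps)
  have "f z1 \<ge> 1"
  proof -
    define x where "x = a * z1"
    define y where "y = b * z1"
    have xy: "0 < x" "x < 1" "0 < y" "y < 1" using less1[OF z1(2)] ab z1 by (auto simp: x_def y_def)
    have "(\<Sum>k. c_lo q * x ^ k) \<le> S x"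
      unfolding S_def using xy P_ratio_powr
      by (intro suminf_le summable_ratio_powr summable_mult summable_geometric mult_right_mono) auto
    also have "(\<Sum>k. c_lo q * x ^ k) = c_lo q / (1 - x)"
      using xy by (simp add: suminf_mult summable_geometric suminf_geometric)
    finally have "z1 powr \<gamma> * (c_lo q / (1 - x)) \<le> z1 powr \<gamma> * S x"
      by (intro mult_left_mono) auto
    moreover have "1 \<le> z1 powr \<gamma> * (c_lo q / (1 - x)) + x / (1 - x) * (y / (1 - y))"
    proof -
      have g: "g z1 = c_lo q * z1 powr \<gamma> * (1 - y) + x * y - (1 - x) * (1 - y)"
        by (simp add: g_def x_def y_def)
      have "z1 powr \<gamma> * (c_lo q / (1 - x)) = c_lo q * z1 powr \<gamma> * (1 - y) / ((1 - x) * (1 - y))"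
        using xy by simp
      then have "z1 powr \<gamma> * (c_lo q / (1 - x)) + x / (1 - x) * (y / (1 - y))
        = (c_lo q * z1 powr \<gamma> * (1 - y) + x * y) / ((1 - x) * (1 - y))"
        by (simp add: add_divide_distrib)
      moreover have "1 \<le> \<dots>" using z1(3) xy unfolding g by (simp add: pos_le_divide_eq)
      ultimately show ?thesis by simp
    qed
    ultimately show ?thesis by (simp add: f_def x_def y_def)
  qed
  moreover have "f 0 \<le> 1" using \<gamma> by (simp add: f_def)
  moreover have "continuous_on {0..z1} f"
  proof -
    have S: "isCont S x" if x: "\<bar>x\<bar> < 1" for x
    proof -
      obtain K where "\<bar>x\<bar> < K" "K < 1" using dense[OF x] by blast
      then have "summable (\<lambda>k. (P k / p2 ^ k) powr q * K ^ k)"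
        by (intro summable_ratio_powr) linarith
      then have "isCont (\<lambda>x. \<Sum>k. (P k / p2 ^ k) powr q * x ^ k) x"
        by (rule isCont_powser) (use \<open>\<bar>x\<bar> < K\<close> in auto)
      then show ?thesis by (simp only: S_def[abs_def])
    qed
    have "continuous_on {0..z1} (\<lambda>z. S (a * z))"
    proof (rule continuous_on_compose2[where g = S])
      show "continuous_on {x. \<bar>x\<bar> < 1} S"
        using S by (intro continuous_at_imp_continuous_on) auto
      show "(\<lambda>z. a * z) ` {0..z1} \<subseteq> {x. \<bar>x\<bar> < 1}"
        using less1[OF z1(2)] z1 ab by auto
    qed (intro continuous_intros)
    moreover have "1 - a * z \<noteq> 0" "1 - b * z \<noteq> 0" if "z \<in> {0..z1}" for z
      using less1[of z] that z1 by auto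
    ultimately show ?thesis
      unfolding f_def using \<gamma> by (intro continuous_intros continuous_on_powr') auto
  qed
  ultimately obtain z where z: "0 \<le> z" "z \<le> z1" "f z = 1"
    using IVT'[of f 0 1 z1] z1 by auto
  \<comment> \<open>\<open>f 0 = 0\<close>, because \<open>0 powr \<gamma>\<close> is 0; the left
    endpoint corresponds to no finite exponent.\<close>
  have "z \<noteq> 0" using z(3) \<gamma> by (auto simp: f_def)
  then have zpos: "z > 0" using z by simp
  define t where "t = - ln z / ln r"
  have "r powr (- t) = z" "\<rho> powr (- t) = z powr \<gamma>"
    using r \<rho> zpos by (auto simp: powr_def t_def \<gamma>_def)
  then have "X q t = a * z" "Y q t = b * z" "(\<Sum>k. block_term q t k) = z powr \<gamma> * S (a * z)"
    using less1[of z] z z1 ab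
    by (auto simp: X_def Y_def a_def b_def S_def block_term_eq intro!: suminf_mult summable_ratio_powr)
  moreover have "a * z < 1" "b * z < 1" using less1[of z] z z1 by auto
  ultimately show ?thesis
    using z(3) by (intro exI[of _ t]) (simp add: pressure_def f_def)
qed

text \<open>The choice is harmless: any exponent with these three properties turns out to be the
  value of the spectrum at \<open>q\<close>.\<close>

definition crit :: "real \<Rightarrow> real" where
  "crit q = (SOME t. X q t < 1 \<and> Y q t < 1 \<and> pressure q t = 1)"

lemma crit: "X q (crit q) < 1" "Y q (crit q) < 1" "pressure q (crit q) = 1"
  using someI_ex[OF ex_critical_exponent[of q]] by (auto simp: crit_def)

text \<open>Indices of the terms of \<open>pressure\<close>: \<open>(i, 0)\<close> stands for the
  block \<open>2^i 1\<close>, and \<open>(i, Suc j)\<close> for the term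
  \<open>X ^ Suc i * Y ^ Suc j\<close> of the product of two geometric series. Each term is then the
  exponential of a linear function of \<open>(q, t)\<close>.\<close>

definition log_weight :: "nat \<times> nat \<Rightarrow> real" where
  "log_weight = (\<lambda>(i, j). case j of 0 \<Rightarrow> ln (P i) | Suc j \<Rightarrow> Suc i * ln p2 + Suc j * ln p3)"

definition log_ratio :: "nat \<times> nat \<Rightarrow> real" where
  "log_ratio = (\<lambda>(i, j). case j of 0 \<Rightarrow> - ln (\<rho> * r ^ i) | Suc j \<Rightarrow> - (Suc i + Suc j) * ln r)"

lemma has_sum_pressure:
  assumes "X q t < 1" "Y q t < 1"
  shows "((\<lambda>e. exp (q * log_weight e + t * log_ratio e)) has_sum pressure q t) UNIV"
proof -
  define f where "f e = exp (q * log_weight e + t * log_ratio e)" for e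
  have f0: "f (i, 0) = block_term q t i" for i
    using \<rho> r by (simp add: f_def log_weight_def log_ratio_def block_term_def powr_def less_imp_neq[THEN not_sym] flip: exp_add)
  have fS: "f (i, Suc j) = X q t ^ Suc i * Y q t ^ Suc j" for i j
  proof -
    have X: "X q t = exp (q * ln p2 - t * ln r)" and Y: "Y q t = exp (q * ln p3 - t * ln r)"
      using p_pos r by (simp_all add: X_def Y_def powr_def flip: exp_add)
    show ?thesis
      unfolding X Y exp_of_nat_mult[symmetric] exp_add[symmetric] f_def log_weight_def log_ratio_def
      by (simp add: algebra_simps)
  qed
  have geo: "(\<lambda>j. Z ^ Suc j) sums (Z / (1 - Z))" if "0 < Z" "Z < 1" for Z :: real
    using sums_mult[OF geometric_sums[of Z], of Z] that by simp
  have inner: "((\<lambda>j. f (i, j)) has_sum (block_term q t i + X q t ^ Suc i * (Y q t / (1 - Y q t)))) UNIV" for i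
  proof (rule sums_nonneg_imp_has_sum)
    have "(\<lambda>j. f (i, Suc j)) sums (X q t ^ Suc i * (Y q t / (1 - Y q t)))"
      unfolding fS using assms by (intro sums_mult geo) auto
    then show "(\<lambda>j. f (i, j)) sums (block_term q t i + X q t ^ Suc i * (Y q t / (1 - Y q t)))"
      using sums_Suc[of "\<lambda>j. f (i, j)"] by (metis f0 add.commute)
  qed (simp add: f_def)
  have outer: "((\<lambda>i. block_term q t i + X q t ^ Suc i * (Y q t / (1 - Y q t))) has_sum pressure q t) UNIV"
  proof (rule sums_nonneg_imp_has_sum)
    show "(\<lambda>i. block_term q t i + X q t ^ Suc i * (Y q t / (1 - Y q t))) sums pressure q t"
      unfolding pressure_def using assms
      by (intro sums_add sums_mult2 geo summable_sums summable_block_term) auto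
    show "block_term q t i + X q t ^ Suc i * (Y q t / (1 - Y q t)) \<ge> 0" for i
      using assms by (intro add_nonneg_nonneg mult_nonneg_nonneg divide_nonneg_nonneg zero_le_power) (auto simp: less_imp_le)
  qed
  have "(f has_sum pressure q t) (Sigma UNIV (\<lambda>_. UNIV))"
  proof (rule has_sum_SigmaI[OF inner outer])
    show "f summable_on Sigma UNIV (\<lambda>_. UNIV)"
      using inner outer by (intro summable_on_SigmaI[OF inner]) (auto simp: f_def has_sum_imp_summable)
  qed
  then show ?thesis by (simp add: f_def[abs_def])
qed

lemma crit_differentiable: "crit differentiable (at q)"
proof (rule exponential_sum_level_set_differentiable)
  have "ln (r ^ i) \<le> 0" "ln p2 < 0" "ln p3 < 0" "ln r < 0" "ln \<rho> < 0" for i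
    using p_pos p_sum r \<rho> by (auto intro: power_le_one)
  note ln_neg = this
  show "log_weight e \<le> 0" for e
    using ln_neg P_le_1 by (auto simp: log_weight_def split: prod.split nat.split intro!: add_nonpos_nonpos mult_nonneg_nonpos)
  show "0 < log_ratio e" for e
  proof -
    have "\<rho> * r ^ i < 1" for i
    proof -
      have "\<rho> * r ^ i \<le> \<rho> * 1" using \<rho> r by (intro mult_left_mono power_le_one) auto
      then show ?thesis using \<rho> by linarith
    qed
    then have "ln (\<rho> * r ^ i) < 0" for i
      using \<rho> r by simp
    then show ?thesis
      using ln_neg by (auto simp: log_ratio_def split: prod.split nat.split intro!: mult_neg_neg)
  qed
  show "((\<lambda>e. exp (q * log_weight e + crit q * log_ratio e)) has_sum 1) UNIV" for q
    using has_sum_pressure[OF crit(1,2)] by (simp add: crit(3))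
  show "\<exists>\<delta>>0. (\<lambda>e. exp ((q - \<delta>) * log_weight e + (crit q + \<delta>) * log_ratio e)) summable_on UNIV" for q
  proof -
    \<comment> \<open>\<open>X < 1\<close> and \<open>Y < 1\<close> are open conditions, so they
      survive a small step beyond the critical point. This is where the critical exponent has to be
      interior to the domain of convergence.\<close>
    have "isCont (\<lambda>\<delta>. X (q - \<delta>) (crit q + \<delta>)) 0" "isCont (\<lambda>\<delta>. Y (q - \<delta>) (crit q + \<delta>)) 0"
      unfolding X_def Y_def using p_pos r by (auto intro!: continuous_intros)
    then have "((\<lambda>\<delta>. X (q - \<delta>) (crit q + \<delta>)) \<longlongrightarrow> X q (crit q)) (at_right 0)"
      "((\<lambda>\<delta>. Y (q - \<delta>) (crit q + \<delta>)) \<longlongrightarrow> Y q (crit q)) (at_right 0)"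
      by (auto simp: isCont_def intro: tendsto_within_subset)
    then have "\<forall>\<^sub>F \<delta> in at_right 0. X (q - \<delta>) (crit q + \<delta>) < 1 \<and> Y (q - \<delta>) (crit q + \<delta>) < 1 \<and> \<delta> > 0"
      using order_tendstoD(2) crit(1,2) by (intro eventually_conj eventually_at_right_less) blast+
    then obtain \<delta> where "X (q - \<delta>) (crit q + \<delta>) < 1 \<and> Y (q - \<delta>) (crit q + \<delta>) < 1 \<and> \<delta> > 0"
      using eventually_happens trivial_limit_at_right_real by blast
    then show ?thesis
      using has_sum_pressure has_sum_imp_summable by blast
  qed
qed

end

section \<open>The measure under the three similarities\<close>

definition aff :: "real \<Rightarrow> real \<Rightarrow> real \<Rightarrow> real" where "aff c s x = c + s * x"

lemma inj_aff: "s \<noteq> 0 \<Longrightarrow> inj (aff c s)"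
  by (auto simp: inj_def aff_def)

lemma aff_image_eq_vimage: "s \<noteq> 0 \<Longrightarrow> aff c s ` E = (\<lambda>y. (y - c) / s) -` E"
proof (intro equalityI subsetI)
  fix y assume "s \<noteq> 0" "y \<in> (\<lambda>y. (y - c) / s) -` E"
  then show "y \<in> aff c s ` E" by (intro image_eqI[of _ _ "(y - c) / s"]) (auto simp: aff_def)
qed (auto simp: aff_def)

lemma aff_image_borel: "s \<noteq> 0 \<Longrightarrow> E \<in> sets borel \<Longrightarrow> aff c s ` E \<in> sets borel"
  unfolding aff_image_eq_vimage using measurable_sets[of "\<lambda>y. (y - c) / s" borel borel E] by simp

lemma aff_vimage_borel: "E \<in> sets borel \<Longrightarrow> aff c s -` E \<in> sets borel"
  unfolding aff_def[abs_def] using measurable_sets[of "\<lambda>y. c + s * y" borel borel E] by simp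

lemma aff_aff_image: "aff c s ` (aff d u ` E) = aff (c + s * d) (s * u) ` E"
  by (auto simp: aff_def image_image algebra_simps)

lemma aff_image_greaterThanLessThan:
  assumes "s > 0"
  shows "aff c s ` {a<..<b} = {c + s * a<..<c + s * b}"
  using assms unfolding aff_image_eq_vimage[OF less_imp_neq[OF assms, THEN not_sym]]
  by (auto simp: field_simps)

locale overlap_measure = overlap_weights \<rho> r p1 p2 p3 + prob_space \<mu>
  for \<rho> r p1 p2 p3 :: real and \<mu> :: "real measure" +
  assumes cond: "\<rho> + 2 * r - \<rho> * r \<le> 1"
    and sets_eq [simp, measurable_cong]: "sets \<mu> = sets borel"
    and self_similar: "\<And>E. E \<in> sets borel \<Longrightarrow> prob E = p1 * prob (aff 0 \<rho> -` E)
      + p2 * prob (aff (\<rho> * (1 - r)) r -` E) + p3 * prob (aff (1 - r) r -` E)"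
begin

lemma space_eq [simp]: "space \<mu> = UNIV"
  using sets_eq_imp_space_eq[OF sets_eq] by simp

abbreviation S1 :: "real \<Rightarrow> real" where "S1 \<equiv> aff 0 \<rho>"
abbreviation S2 :: "real \<Rightarrow> real" where "S2 \<equiv> aff (\<rho> * (1 - r)) r"
abbreviation S3 :: "real \<Rightarrow> real" where "S3 \<equiv> aff (1 - r) r"
abbreviation J :: "real set" where "J \<equiv> {0<..<1}"

text \<open>
  \<open>\<beta> = S2 1\<close>. As \<open>S1 \<circ> S3 = S2 \<circ> S1\<close>, only the part of the attractor in \<open>{0..\<beta>}\<close> has to be
  kept after an application of \<open>S1\<close>.
\<close>

definition \<beta> :: real where "\<beta> = \<rho> + r - \<rho> * r"

text \<open>\<open>\<beta> \<le> 1 - r\<close> is \<open>cond\<close> rewritten; it says that the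
  images of \<open>J\<close> under \<open>S2\<close> and \<open>S3\<close> do not overlap.\<close>

lemma \<beta>: "0 < \<beta>" "\<beta> \<le> 1 - r" "\<beta> < 1" "\<rho> \<le> \<beta>" "\<rho> < 1 - r" "\<rho> * (1 - r) \<le> 1 - 2 * r"
proof -
  have "\<rho> * r < 1 * r" using \<rho> r by (intro mult_strict_right_mono) auto
  then show "0 < \<beta>" "\<rho> \<le> \<beta>" using \<rho> r unfolding \<beta>_def by linarith+
  show "\<beta> \<le> 1 - r" using cond by (simp add: \<beta>_def)
  then show "\<beta> < 1" using r by simp
  show "\<rho> < 1 - r" using \<open>\<rho> * r < 1 * r\<close> cond by simp
  show "\<rho> * (1 - r) \<le> 1 - 2 * r" using cond by (simp add: algebra_simps)
qed

text \<open>A point whose image under one of the maps has distance more than \<open>e\<close> from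
  the unit interval is itself farther than \<open>e / c\<close> from it. Self-similarity thus pushes
  the mass outwards without loss, and the sets reached shrink to the empty set.\<close>

lemma prob_far_from_unit_interval:
  assumes "e > 0"
  shows "prob {x. x < - e \<or> 1 + e < x} = 0"
proof -
  define N where "N e = {x::real. x < - e \<or> 1 + e < x}" for e
  define c where "c = max \<rho> r"
  have c: "0 < c" "c < 1" "\<rho> \<le> c" "r \<le> c" using \<rho> r by (auto simp: c_def)
  have N [measurable]: "N e \<in> sets borel" for e unfolding N_def by measurable
  have step: "prob (N e) \<le> prob (N (e / c))" if e: "e > 0" for e
  proof -
    have ec: "\<rho> * (e / c) \<le> e" "r * (e / c) \<le> e" using c e by (auto simp: field_simps)
    have far: "x \<in> N (e / c)" if "u > 0" "u * (e / c) \<le> e" "u * x < - e \<or> u + e < u * x" for x u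
    proof -
      have "u * x < u * (- (e / c)) \<or> u * (1 + e / c) < u * x"
        using that(2,3) by (simp add: algebra_simps) linarith
      then show ?thesis
        unfolding N_def mem_Collect_eq mult_less_cancel_left_pos[OF that(1)] .
    qed
    have "S1 -` N e \<subseteq> N (e / c)"
    proof
      fix x assume "x \<in> S1 -` N e"
      then show "x \<in> N (e / c)" using \<rho> ec by (intro far[of \<rho>]) (auto simp: N_def aff_def)
    qed
    moreover have "S2 -` N e \<subseteq> N (e / c)"
    proof
      fix x assume "x \<in> S2 -` N e"
      moreover have "0 \<le> \<rho> * (1 - r)" using \<rho> r by simp
      ultimately show "x \<in> N (e / c)" using r ec \<beta>(6) by (intro far[of r]) (auto simp: N_def aff_def)
    qed
    moreover have "S3 -` N e \<subseteq> N (e / c)"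
    proof
      fix x assume "x \<in> S3 -` N e"
      then show "x \<in> N (e / c)" using r ec by (intro far[of r]) (auto simp: N_def aff_def)
    qed
    ultimately have "prob (N e) \<le> p1 * prob (N (e / c)) + p2 * prob (N (e / c)) + p3 * prob (N (e / c))"
      using p_pos by (subst self_similar[OF N], intro add_mono mult_left_mono finite_measure_mono) auto
    also have "\<dots> = (p1 + p2 + p3) * prob (N (e / c))" by (simp add: algebra_simps)
    finally show ?thesis by (simp add: p_sum)
  qed
  have iterate: "prob (N e) \<le> prob (N (e / c ^ n))" for n
  proof (induction n)
    case (Suc n)
    also have "prob (N (e / c ^ n)) \<le> prob (N (e / c ^ n / c))" using assms c by (intro step) auto
    finally show ?case by (simp add: divide_divide_eq_left mult.commute)
  qed simp
  have "prob (N e) \<le> prob (N (real m))" for m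
  proof -
    obtain n where n: "c ^ n < e / (real m + 1)"
      using real_arch_pow_inv[of "e / (real m + 1)" c] c assms by auto
    then have "c ^ n * (real m + 1) < e" by (simp add: pos_less_divide_eq)
    then have "real m \<le> e / c ^ n" using c by (simp add: pos_le_divide_eq algebra_simps) (smt (verit) zero_less_power)
    then have "N (e / c ^ n) \<subseteq> N (real m)" by (auto simp: N_def)
    then have "prob (N (e / c ^ n)) \<le> prob (N (real m))" by (intro finite_measure_mono) auto
    then show ?thesis using iterate[of n] by linarith
  qed
  moreover have "(\<lambda>m. prob (N (real m))) \<longlonglongrightarrow> prob (\<Inter>m. N (real m))"
    by (rule finite_Lim_measure_decseq) (auto simp: decseq_def N_def)
  moreover have "(\<Inter>m. N (real m)) = {}"
  proof -
    have "x \<notin> N (real m)" if "real m > \<bar>x\<bar>" for x m using that by (auto simp: N_def)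
    then show ?thesis by (metis INT_iff UNIV_I all_not_in_conv reals_Archimedean2)
  qed
  ultimately have "prob (N e) \<le> 0" by (intro LIMSEQ_le_const[of "\<lambda>m. prob (N (real m))"]) auto
  then show ?thesis by (simp add: N_def measure_le_0_iff)
qed

lemma prob_outside_closed: 
  assumes "E \<in> sets borel" "E \<inter> {0..1} = {}"
  shows "prob E = 0"
proof -
  have "AE x in \<mu>. \<forall>n::nat. x \<notin> {x. x < - (1 / Suc n) \<or> 1 + 1 / Suc n < x}"
    unfolding AE_all_countable
  proof
    fix n
    show "AE x in \<mu>. x \<notin> {x. x < - (1 / Suc n) \<or> 1 + 1 / Suc n < x}"
      by (rule AE_I[of _ _ "{x. x < - (1 / Suc n) \<or> 1 + 1 / Suc n < x}"])
        (use prob_far_from_unit_interval[of "1 / Suc n"] in \<open>auto simp: emeasure_eq_measure\<close>)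
  qed
  then have "AE x in \<mu>. x \<notin> E"
  proof (rule AE_mp, intro AE_I2 impI notI)
    fix x assume *: "\<forall>n::nat. x \<notin> {x. x < - (1 / Suc n) \<or> 1 + 1 / Suc n < x}" and "x \<in> E"
    then consider "x < 0" | "x > 1" using assms by force
    then show False
    proof cases
      case 1
      then obtain n where "1 / Suc n < - x" using nat_approx_posE[of "- x"] by auto
      then show False using *[rule_format, of n] by auto
    next
      case 2
      then obtain n where "1 / Suc n < x - 1" using nat_approx_posE[of "x - 1"] by auto
      then show False using *[rule_format, of n] by auto
    qed
  qed
  then show ?thesis using assms(1) by (simp add: prob_eq_0)
qed

text \<open>Only \<open>S1\<close> maps a point of the unit interval to 0, namely 0 itself, so the
  mass at 0 equals \<open>p1\<close> times itself; likewise \<open>S3\<close> at 1. This permits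
  open cells, so that touching cells are disjoint.\<close>

lemma prob_endpoints: "prob {0} = 0" "prob {1} = 0"
proof -
  have "prob {0} = p1 * prob {0} + p2 * 0 + p3 * 0"
  proof -
    have "S1 -` {0} = {0}" using \<rho> by (auto simp: aff_def)
    moreover have "x < 0" if "S2 x = 0" for x
    proof -
      have "0 < \<rho> * (1 - r)" using \<rho> r by simp
      then have "r * x < 0" using that by (simp add: aff_def)
      then show ?thesis using r by (simp add: mult_less_0_iff)
    qed
    then have "prob (S2 -` {0}) = 0" by (intro prob_outside_closed aff_vimage_borel) force+
    moreover have "x < 0" if "S3 x = 0" for x
    proof -
      have "r * x < 0" using that r by (simp add: aff_def)
      then show ?thesis using r by (simp add: mult_less_0_iff)
    qed
    then have "prob (S3 -` {0}) = 0" by (intro prob_outside_closed aff_vimage_borel) force+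
    ultimately show ?thesis using self_similar[of "{0}"] by simp
  qed
  then have "(1 - p1) * prob {0} = 0" by (simp add: algebra_simps)
  then show "prob {0} = 0" using p_pos p_sum by auto
  have "prob {1} = p1 * 0 + p2 * 0 + p3 * prob {1}"
  proof -
    have "x > 1" if "S1 x = 1" for x using that \<rho> mult_left_mono[of x 1 \<rho>] by (force simp: aff_def)
    then have "prob (S1 -` {1}) = 0" by (intro prob_outside_closed aff_vimage_borel) force+
    moreover have "x > 1" if "S2 x = 1" for x
    proof -
      have "r * x > r * 1" using that \<beta>(6) r unfolding aff_def by linarith
      then show ?thesis using r by (simp add: mult_less_cancel_left_pos)
    qed
    then have "prob (S2 -` {1}) = 0" by (intro prob_outside_closed aff_vimage_borel) force+
    moreover have "S3 -` {1} = {1}" using r by (auto simp: aff_def)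
    ultimately show ?thesis using self_similar[of "{1}"] by simp
  qed
  then have "(1 - p3) * prob {1} = 0" by (simp add: algebra_simps)
  then show "prob {1} = 0" using p_pos p_sum by auto
qed

lemma prob_outside:
  assumes "E \<in> sets borel" "E \<inter> J = {}"
  shows "prob E = 0"
proof -
  have "E \<subseteq> (E - {0..1}) \<union> ({0} \<union> {1})" using assms(2) by force
  then have "prob E \<le> prob ((E - {0..1}) \<union> ({0} \<union> {1}))"
    using assms(1) by (intro finite_measure_mono) auto
  also have "\<dots> \<le> prob (E - {0..1}) + (prob {0} + prob {1})"
    using assms(1) by (intro order_trans[OF measure_Un_le] add_left_mono measure_Un_le) auto
  also have "prob (E - {0..1}) = 0" using assms(1) by (intro prob_outside_closed) auto
  also have "0 + (prob {0} + prob {1}) = 0" by (simp add: prob_endpoints)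
  finally show ?thesis by (simp add: measure_le_0_iff)
qed

text \<open>Preimages under the maps stick out of \<open>J\<close>; their descriptions need to be
  correct inside \<open>J\<close> only.\<close>

lemma prob_cong:
  assumes "E \<in> sets borel" "F \<in> sets borel" "E \<inter> J = F \<inter> J"
  shows "prob E = prob F"
proof -
  have "prob E = prob (E \<inter> J)" if "E \<in> sets borel" for E
  proof -
    have "prob E = prob ((E \<inter> J) \<union> (E - J))" by (simp add: Int_Diff_Un)
    also have "\<dots> = prob (E \<inter> J) + prob (E - J)" using that by (intro finite_measure_Union) auto
    also have "prob (E - J) = 0" using that by (intro prob_outside) auto
    finally show ?thesis by simp
  qed
  then show ?thesis using assms by metis
qed

lemma prob_J: "prob J = 1"
  using prob_cong[of J UNIV] prob_space by simp

section \<open>How the measure transforms under each of the three maps\<close>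

lemma aff_inj [simp]: "aff c \<rho> x = aff c \<rho> y \<longleftrightarrow> x = y" "aff c r x = aff c r y \<longleftrightarrow> x = y"
  using \<rho> r by (auto simp: aff_def)

lemma ratios_nonzero: "\<rho> \<noteq> 0" "r \<noteq> 0" using \<rho> r by auto

lemma vimage_image_S [simp]: "aff c \<rho> -` (aff c \<rho> ` E) = E" "aff c r -` (aff c r ` E) = E"
  by auto

lemma S_ranges:
  assumes "x \<in> J"
  shows "S1 x \<in> {0<..<\<rho>}" "S2 x \<in> {\<rho> * (1 - r)<..<\<beta>}" "S3 x \<in> {1 - r<..<1}"
  using assms \<rho> r by (auto simp: aff_def \<beta>_def algebra_simps)

lemma prob_S3:
  assumes "E \<in> sets borel" "E \<subseteq> J"
  shows "prob (S3 ` E) = p3 * prob E"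
proof -
  have "S1 x \<noteq> S3 y" "S2 x \<noteq> S3 y" if "x \<in> J" "y \<in> J" for x y
    using S_ranges[OF that(1)] S_ranges[OF that(2)] \<beta> by auto
  then have "S1 -` S3 ` E \<inter> J = {}" "S2 -` S3 ` E \<inter> J = {}"
    using assms(2) by auto
  then show ?thesis
    using self_similar[of "S3 ` E"] assms(1) ratios_nonzero by (simp add: prob_outside aff_vimage_borel aff_image_borel)
qed

text \<open>Below \<open>\<beta>\<close> the image under \<open>S1\<close> stays below
  \<open>\<rho> * \<beta> \<le> \<rho> * (1 - r)\<close>, where the image of \<open>J\<close> under
  \<open>S2\<close> begins. Only the \<open>S1\<close> term of the self-similarity relation
  survives.\<close>

lemma prob_S1:
  assumes "E \<in> sets borel" "E \<subseteq> {0<..<\<beta>}"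
  shows "prob (S1 ` E) = p1 * prob E"
proof -
  have "S2 x \<noteq> S1 y" "S3 x \<noteq> S1 y" if "x \<in> J" "y \<in> {0<..<\<beta>}" for x y
  proof -
    have "y \<in> J" using that(2) \<beta> by auto
    have "S1 y \<le> \<rho> * \<beta>" using that(2) \<rho> by (simp add: aff_def)
    also have "\<dots> \<le> \<rho> * (1 - r)" using \<rho> \<beta> by (intro mult_left_mono) auto
    finally show "S2 x \<noteq> S1 y" "S3 x \<noteq> S1 y"
      using S_ranges[OF that(1)] S_ranges[OF \<open>y \<in> J\<close>] \<beta> by auto
  qed
  then have "S2 -` S1 ` E \<inter> J = {}" "S3 -` S1 ` E \<inter> J = {}"
    using assms(2) by auto
  then show ?thesis
    using self_similar[of "S1 ` E"] assms(1) ratios_nonzero by (simp add: prob_outside aff_vimage_borel aff_image_borel)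
qed

text \<open>
  The restriction of the measure to \<open>S2 ` J\<close> is not a copy of the measure, but pulled back to
  \<open>J\<close> it is a linear combination of the measure and \<open>\<nu>\<close>.
\<close>

definition \<nu> :: "real set \<Rightarrow> real" where "\<nu> E = prob (S1 -` E)"

lemma \<nu>_S1: "\<nu> (S1 ` E) = prob E"
  by (simp add: \<nu>_def)

lemma \<nu>_S3:
  assumes "E \<in> sets borel" "E \<subseteq> J"
  shows "\<nu> (S3 ` E) = 0"
proof -
  have "S1 x \<noteq> S3 y" if "x \<in> J" "y \<in> J" for x y
    using S_ranges[OF that(1)] S_ranges[OF that(2)] \<beta> by auto
  then have "S1 -` S3 ` E \<inter> J = {}" using assms(2) by auto
  then show ?thesis
    using assms(1) ratios_nonzero by (simp add: \<nu>_def prob_outside aff_vimage_borel aff_image_borel)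
qed

text \<open>The overlap identity at work: inside \<open>J\<close>, the \<open>S1\<close>-preimage of
  the \<open>S2\<close>-image of \<open>E\<close> is the \<open>S3\<close>-image of the
  \<open>S1\<close>-preimage of \<open>E\<close>, and \<open>S3\<close> contributes the factor
  \<open>p3\<close>.\<close>

lemma \<nu>_S2:
  assumes "E \<in> sets borel" "E \<subseteq> J"
  shows "\<nu> (S2 ` E) = p3 * \<nu> E"
proof -
  have comm: "S1 (S3 z) = S2 (S1 z)" for z by (simp add: aff_def algebra_simps)
  have "S1 -` (S2 ` E) \<inter> J = S3 ` (S1 -` E \<inter> J) \<inter> J"
  proof (intro equalityI subsetI)
    fix x assume x: "x \<in> S1 -` (S2 ` E) \<inter> J"
    then obtain y where y: "y \<in> E" "S1 x = S2 y" by auto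
    \<comment> \<open>A point that \<open>S1\<close> sends into the image of \<open>S2\<close> lies
      beyond \<open>1 - r\<close>, hence in the image of \<open>J\<close> under
      \<open>S3\<close>.\<close>
    then have "\<rho> * (1 - r) < \<rho> * x" using S_ranges(2)[of y] assms(2) by (auto simp: aff_def)
    then have "1 - r < x" using \<rho> by (simp add: mult_less_cancel_left_pos)
    define z where "z = (x - (1 - r)) / r"
    have z: "S3 z = x" "z \<in> J" using r x \<open>1 - r < x\<close> by (auto simp: z_def aff_def field_simps)
    then have "S2 (S1 z) = S2 y" using comm[of z] y by simp
    then have "S1 z = y" by simp
    then show "x \<in> S3 ` (S1 -` E \<inter> J) \<inter> J" using z y x by auto
  next
    fix x assume "x \<in> S3 ` (S1 -` E \<inter> J) \<inter> J"
    then show "x \<in> S1 -` (S2 ` E) \<inter> J" using comm by auto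
  qed
  then have "\<nu> (S2 ` E) = prob (S3 ` (S1 -` E \<inter> J))"
    unfolding \<nu>_def using assms(1) ratios_nonzero
    by (intro prob_cong) (auto intro!: aff_vimage_borel aff_image_borel)
  also have "\<dots> = p3 * prob (S1 -` E \<inter> J)"
    using assms(1) by (intro prob_S3) (auto intro!: aff_vimage_borel)
  also have "prob (S1 -` E \<inter> J) = \<nu> E"
    unfolding \<nu>_def using assms(1) by (intro prob_cong) (auto intro!: aff_vimage_borel)
  finally show ?thesis .
qed

text \<open>The \<open>S1\<close> term contributes \<open>p1\<close> times \<open>\<nu>\<close> of
  the image. Together with \<open>\<nu>_S2\<close>, the pair of \<open>prob\<close> and
  \<open>\<nu>\<close> is transformed by a triangular matrix with diagonal \<open>p2\<close>,
  \<open>p3\<close>; its powers produce the block weights.\<close>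

lemma prob_S2:
  assumes "E \<in> sets borel" "E \<subseteq> J"
  shows "prob (S2 ` E) = p2 * prob E + p1 * p3 * \<nu> E"
proof -
  have "S3 x \<noteq> S2 y" if "x \<in> J" "y \<in> J" for x y
    using S_ranges[OF that(1)] S_ranges[OF that(2)] \<beta> by auto
  then have "S3 -` S2 ` E \<inter> J = {}" using assms(2) by auto
  then have "prob (S3 -` S2 ` E) = 0"
    using assms(1) ratios_nonzero by (intro prob_outside aff_vimage_borel aff_image_borel)
  then show ?thesis
    using self_similar[of "S2 ` E"] \<nu>_S2[OF assms] assms(1) ratios_nonzero
    by (simp add: aff_image_borel \<nu>_def)
qed

lemma \<nu>_nonneg: "\<nu> E \<ge> 0" by (simp add: \<nu>_def)

lemma \<nu>_J: "\<nu> J = 1"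
proof -
  have "S1 -` J \<inter> J = J \<inter> J" using S_ranges(1) \<rho> by force
  then have "prob (S1 -` J) = prob J"
    by (intro prob_cong aff_vimage_borel) auto
  then show ?thesis by (simp add: \<nu>_def prob_J)
qed

lemma prob_\<beta>: "prob {0<..<\<beta>} = p1 + p2"
proof -
  have "prob (S1 -` {0<..<\<beta>}) = prob J" "prob (S2 -` {0<..<\<beta>}) = prob J"
    using S_ranges(1,2) \<beta> \<rho> r by (force intro!: prob_cong aff_vimage_borel intro: less_trans[of 0 "\<rho> * (1 - r)"])+
  moreover have "prob (S3 -` {0<..<\<beta>}) = 0"
    using S_ranges(3) \<beta> by (intro prob_outside aff_vimage_borel) force+
  ultimately show ?thesis
    using self_similar[of "{0<..<\<beta>}"] by (simp add: prob_J)
qed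

end

section \<open>Cells and their energy\<close>

context overlap_weights
begin

text \<open>
  \<open>(1, 1 - Y)\<close> is the eigenvector of the matrix above for the eigenvalue 1; its entry for a word
  ending in a run of \<open>k\<close> twos is obtained by summing over the ways in which the run continues.
\<close>

definition tail_energy :: "real \<Rightarrow> nat \<Rightarrow> real" where
  "tail_energy q k = (\<Sum>j. block_term q (crit q) (k + j) * (1 - Y q (crit q))
     + X q (crit q) ^ (k + j) * Y q (crit q))"

lemma summable_tail_energy:
  "summable (\<lambda>j. block_term q (crit q) (k + j) * (1 - Y q (crit q)) + X q (crit q) ^ (k + j) * Y q (crit q))"
proof -
  have "summable (\<lambda>j. block_term q (crit q) (j + k))" "summable (\<lambda>j. X q (crit q) ^ (j + k))"
    using crit by (intro summable_ignore_initial_segment summable_block_term summable_geometric; simp add: less_imp_le)+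
  then show ?thesis
    by (intro summable_add summable_mult2) (simp_all add: add.commute)
qed

lemma tail_energy_rec:
  "tail_energy q k = block_term q (crit q) k * (1 - Y q (crit q)) + X q (crit q) ^ k * Y q (crit q)
    + tail_energy q (Suc k)"
  using suminf_split_head[OF summable_tail_energy[of q k]] by (simp add: tail_energy_def)

text \<open>The first row of the eigenvector equation, in which the pressure equation is used: with
  \<open>Z\<close> the sum of the block terms it reads
  \<open>Z * (1 - Y) + Y / (1 - X) = 1\<close>.\<close>

lemma tail_energy_0: "tail_energy q 0 = 1"
proof -
  define x where "x = X q (crit q)"
  define y where "y = Y q (crit q)"
  have xy: "x < 1" "y < 1" "x > 0" using crit[of q] by (auto simp: x_def y_def)
  have "(\<lambda>j. block_term q (crit q) j * (1 - y) + x ^ j * y) sums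
      ((\<Sum>j. block_term q (crit q) j) * (1 - y) + 1 / (1 - x) * y)"
    using xy by (intro sums_add sums_mult2 summable_sums summable_block_term geometric_sums) (auto simp: x_def abs_of_pos)
  then have "tail_energy q 0 = (\<Sum>j. block_term q (crit q) j) * (1 - y) + y / (1 - x)"
    by (simp add: tail_energy_def sums_iff x_def y_def)
  also have "(\<Sum>j. block_term q (crit q) j) = 1 - x / (1 - x) * (y / (1 - y))"
    using crit(3)[of q] by (simp add: pressure_def x_def y_def)
  also have "(1 - x / (1 - x) * (y / (1 - y))) * (1 - y) + y / (1 - x) = 1"
  proof -
    have "x / (1 - x) * (y / (1 - y)) * (1 - y) = x / (1 - x) * y" using xy by simp
    then have "(1 - x / (1 - x) * (y / (1 - y))) * (1 - y) = (1 - y) - x / (1 - x) * y"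
      by (simp add: left_diff_distrib)
    moreover have "y / (1 - x) - x / (1 - x) * y = y"
    proof -
      have "y / (1 - x) - x / (1 - x) * y = y * (1 - x) / (1 - x)"
        by (simp add: diff_divide_distrib[symmetric] algebra_simps)
      then show ?thesis using xy by simp
    qed
    ultimately show ?thesis by simp
  qed
  finally show ?thesis .
qed

text \<open>Since \<open>P k\<close> is comparable to \<open>p2 ^ k\<close>, the summands are
  comparable to \<open>X ^ (k + j)\<close>, and the tail of a convergent geometric series is
  comparable to its first term.\<close>

lemma tail_energy_bounds:
  obtains c C where "c > 0" "C > 0" "\<And>k. c * X q (crit q) ^ k \<le> tail_energy q k"
    "\<And>k. tail_energy q k \<le> C * X q (crit q) ^ k"
proof -
  define x where "x = X q (crit q)"
  define y where "y = Y q (crit q)"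
  define R where "R = \<rho> powr (- crit q)"
  have xy: "0 < x" "x < 1" "0 < y" "y < 1" using crit[of q] by (auto simp: x_def y_def)
  have R: "R > 0" using \<rho> by (simp add: R_def)
  define c where "c = R * c_lo q * (1 - y)"
  define D where "D = R * c_hi q * (1 - y) + y"
  have b: "R * c_lo q * x ^ k \<le> block_term q (crit q) k" "block_term q (crit q) k \<le> R * c_hi q * x ^ k" for k
    using P_ratio_powr[where q = q and k = k] R xy
    by (auto simp: block_term_eq R_def[symmetric] x_def[symmetric] mult.assoc intro!: mult_left_mono mult_right_mono)
  show ?thesis
  proof (rule that[of c "D / (1 - x)"])
    show "c > 0" using R xy c_lo_pos[of q] by (simp add: c_def)
    show "D / (1 - x) > 0" using R xy c_hi_pos[of q] by (auto simp: D_def intro!: divide_pos_pos add_pos_pos)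
    fix k
    have nn: "0 \<le> block_term q (crit q) j * (1 - y) + x ^ j * y" for j
      using xy less_imp_le[OF block_term_pos[of q "crit q" j]] by simp
    have "c * x ^ k = R * c_lo q * x ^ k * (1 - y)" by (simp add: c_def)
    also have "\<dots> \<le> block_term q (crit q) k * (1 - y)" using b xy by (intro mult_right_mono) auto
    also have "\<dots> \<le> block_term q (crit q) k * (1 - y) + x ^ k * y" using xy by simp
    also have "\<dots> \<le> tail_energy q k"
    proof -
      have "0 \<le> tail_energy q (Suc k)"
        unfolding tail_energy_def by (rule suminf_nonneg[OF summable_tail_energy]) (use nn in \<open>simp only: x_def y_def\<close>)
      then show ?thesis unfolding tail_energy_rec[of q k] by (simp add: x_def y_def)
    qed
    finally show "c * X q (crit q) ^ k \<le> tail_energy q k" by (simp add: x_def)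
    have "tail_energy q k \<le> (\<Sum>j. D * x ^ k * x ^ j)"
      unfolding tail_energy_def
    proof (rule suminf_le[OF _ summable_tail_energy])
      show "summable (\<lambda>j. D * x ^ k * x ^ j)" using xy by (intro summable_mult summable_geometric) auto
      fix j
      have "block_term q (crit q) (k + j) * (1 - y) \<le> R * c_hi q * x ^ (k + j) * (1 - y)"
        using b xy by (intro mult_right_mono) auto
      then show "block_term q (crit q) (k + j) * (1 - Y q (crit q)) + X q (crit q) ^ (k + j) * Y q (crit q)
          \<le> D * x ^ k * x ^ j"
        by (simp add: D_def x_def[symmetric] y_def[symmetric] power_add algebra_simps)
    qed
    also have "\<dots> = D / (1 - x) * x ^ k"
      using xy by (simp add: suminf_mult summable_geometric suminf_geometric)
    finally show "tail_energy q k \<le> D / (1 - x) * X q (crit q) ^ k" by (simp add: x_def)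
  qed
qed

end

text \<open>
  Cells are indexed by words without the factor 13, recorded through what matters for the measure:
  \<open>A k w s c\<close> stands for a word ending in a maximal run of \<open>k\<close> twos (possibly \<open>k = 0\<close>) after a
  prefix of weight \<open>w\<close>, \<open>B w s c\<close> for a word ending in 1; \<open>s\<close> and \<open>c\<close> are the ratio and the
  translation part of the corresponding similarity.
\<close>

datatype node = A nat real real real | B real real real

context overlap_measure
begin

fun scale :: "node \<Rightarrow> real" where
  "scale (A k w s c) = s"
| "scale (B w s c) = s"

fun offset :: "node \<Rightarrow> real" where
  "offset (A k w s c) = c"
| "offset (B w s c) = c"

fun core :: "node \<Rightarrow> real set" where
  "core (A k w s c) = {0<..<1}"
| "core (B w s c) = {0<..<\<beta>}"

definition cell :: "node \<Rightarrow> real set" where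
  "cell v = aff (offset v) (scale v) ` core v"

text \<open>The coefficient of \<open>\<nu>\<close> collects the weights of the words
  \<open>2^a 1 3^b\<close> with \<open>a + b = k\<close> and \<open>b > 0\<close>, that is, the mass
  that enters the cell of \<open>2^k\<close> through the overlap.\<close>

fun good :: "node \<Rightarrow> bool" where
  "good (A k w s c) \<longleftrightarrow> w > 0 \<and> s > 0 \<and> (\<forall>E\<in>sets borel. E \<subseteq> J \<longrightarrow>
     prob (aff c s ` E) = w * (p2 ^ k * prob E + (P k - p1 * p2 ^ k) * \<nu> E))"
| "good (B w s c) \<longleftrightarrow> w > 0 \<and> s > 0 \<and> (\<forall>E\<in>sets borel. E \<subseteq> {0<..<\<beta>} \<longrightarrow>
     prob (aff c s ` E) = w * prob E)"

text \<open>Letter 1 closes the run and collects the whole block weight. Letter 2 prolongs the run,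
  so the weight stays pending. Letter 3 closes it with \<open>p2 ^ k * p3\<close> alone, as
  \<open>\<nu>\<close> vanishes there. After a 1 there is no child for 3, the factor 13 being
  excluded.\<close>

fun kids :: "node \<Rightarrow> node set" where
  "kids (A k w s c) = {B (w * P k) (s * \<rho>) c, A (Suc k) w (s * r) (c + s * (\<rho> * (1 - r))),
     A 0 (w * p2 ^ k * p3) (s * r) (c + s * (1 - r))}"
| "kids (B w s c) = {B (w * p1) (s * \<rho>) c, A 1 w (s * r) (c + s * (\<rho> * (1 - r)))}"

text \<open>The scale \<open>s\<close> includes the ratio \<open>r ^ k\<close> of the pending run,
  which \<open>tail_energy\<close> counts as well; the factor \<open>(r ^ k) powr crit q\<close>
  removes it once.\<close>

fun energy :: "real \<Rightarrow> node \<Rightarrow> real" where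
  "energy q (A k w s c) = w powr q * s powr (- crit q) * (r ^ k) powr crit q * tail_energy q k"
| "energy q (B w s c) = w powr q * s powr (- crit q) * (1 - Y q (crit q))"

lemma good_scale: "good v \<Longrightarrow> scale v > 0"
  by (cases v) auto

lemma S_images: "S1 ` {0<..<\<beta>} \<subseteq> {0<..<\<rho> * (1 - r)}" "S2 ` J = {\<rho> * (1 - r)<..<\<beta>}" "S3 ` J = {1 - r<..<1}"
proof -
  have "\<rho> * \<beta> \<le> \<rho> * (1 - r)" using \<rho> \<beta> by (intro mult_left_mono) auto
  then show "S1 ` {0<..<\<beta>} \<subseteq> {0<..<\<rho> * (1 - r)}"
    unfolding aff_image_greaterThanLessThan[OF \<rho>(1)] by (intro subsetI) simp
  have "\<rho> * (1 - r) + r = \<beta>" by (simp add: \<beta>_def algebra_simps)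
  then show "S2 ` J = {\<rho> * (1 - r)<..<\<beta>}" "S3 ` J = {1 - r<..<1}"
    using r by (simp_all add: aff_image_greaterThanLessThan)
qed

lemma S_images_subset:
  "S1 ` {0<..<\<beta>} \<subseteq> {0<..<\<beta>}" "S1 ` {0<..<\<beta>} \<subseteq> J"
  "S2 ` J \<subseteq> {0<..<\<beta>}" "S2 ` J \<subseteq> J" "S3 ` J \<subseteq> J"
proof -
  have 0: "0 < \<rho> * (1 - r)" "\<rho> * (1 - r) < \<beta>" using \<rho> r by (auto simp: \<beta>_def algebra_simps)
  show 1: "S1 ` {0<..<\<beta>} \<subseteq> {0<..<\<beta>}" "S2 ` J \<subseteq> {0<..<\<beta>}" "S3 ` J \<subseteq> J"
    using S_images 0 r by auto
  have "{0<..<\<beta>} \<subseteq> J" using \<beta> by auto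
  then show "S1 ` {0<..<\<beta>} \<subseteq> J" "S2 ` J \<subseteq> J" using 1(1,2) by (metis order_trans)+
qed

lemma cell_kids:
  "cell (B w (s * \<rho>) c) = aff c s ` (S1 ` {0<..<\<beta>})"
  "cell (A k w (s * r) (c + s * (\<rho> * (1 - r)))) = aff c s ` (S2 ` J)"
  "cell (A k w (s * r) (c + s * (1 - r))) = aff c s ` (S3 ` J)"
  by (simp_all add: cell_def aff_aff_image)

text \<open>The transformation rules are inserted into the law of the parent. Under letter 1 both
  \<open>prob\<close> and \<open>\<nu>\<close> become multiples of \<open>prob\<close>, with
  coefficients adding up to \<open>P k\<close>; under letter 2 the recursion of
  \<open>block_weight\<close> appears.\<close>

lemma good_kids:
  assumes "good v" "u \<in> kids v"
  shows "good u"
proof (cases v)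
  case (A k w s c)
  have v: "w > 0" "s > 0" and E: "\<And>E. E \<in> sets borel \<Longrightarrow> E \<subseteq> J \<Longrightarrow>
     prob (aff c s ` E) = w * (p2 ^ k * prob E + (P k - p1 * p2 ^ k) * \<nu> E)"
    using assms(1) A by auto
  have "good (B (w * P k) (s * \<rho>) c)"
  proof -
    have "prob (aff c (s * \<rho>) ` E) = w * P k * prob E" if "E \<in> sets borel" "E \<subseteq> {0<..<\<beta>}" for E
    proof -
      have "S1 ` E \<subseteq> S1 ` {0<..<\<beta>}" using that(2) by auto
      also note S_images_subset(2)
      finally have "prob (aff c s ` (S1 ` E)) = w * (p2 ^ k * (p1 * prob E) + (P k - p1 * p2 ^ k) * prob E)"
        using that ratios_nonzero by (simp add: E prob_S1 \<nu>_S1 aff_image_borel)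
      then show ?thesis by (simp add: aff_aff_image algebra_simps)
    qed
    then show ?thesis using v \<rho> by simp
  qed
  moreover have "good (A (Suc k) w (s * r) (c + s * (\<rho> * (1 - r))))"
  proof -
    have "prob (aff (c + s * (\<rho> * (1 - r))) (s * r) ` E)
        = w * (p2 ^ Suc k * prob E + (P (Suc k) - p1 * p2 ^ Suc k) * \<nu> E)"
      if "E \<in> sets borel" "E \<subseteq> J" for E
    proof -
      have "S2 ` E \<subseteq> S2 ` J" using that(2) by auto
      also note S_images_subset(4)
      finally have "prob (aff c s ` (S2 ` E))
          = w * (p2 ^ k * (p2 * prob E + p1 * p3 * \<nu> E) + (P k - p1 * p2 ^ k) * (p3 * \<nu> E))"
        using that ratios_nonzero by (simp add: E prob_S2 \<nu>_S2 aff_image_borel)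
      then show ?thesis by (simp add: aff_aff_image algebra_simps)
    qed
    then show ?thesis using v r by simp
  qed
  moreover have "good (A 0 (w * p2 ^ k * p3) (s * r) (c + s * (1 - r)))"
  proof -
    have "prob (aff (c + s * (1 - r)) (s * r) ` E) = w * p2 ^ k * p3 * prob E"
      if "E \<in> sets borel" "E \<subseteq> J" for E
    proof -
      have "S3 ` E \<subseteq> S3 ` J" using that(2) by auto
      also note S_images_subset(5)
      finally have "prob (aff c s ` (S3 ` E)) = w * (p2 ^ k * (p3 * prob E))"
        using that ratios_nonzero by (simp add: E prob_S3 \<nu>_S3 aff_image_borel)
      then show ?thesis by (simp add: aff_aff_image mult_ac)
    qed
    then show ?thesis using v r p_pos by simp
  qed
  ultimately show ?thesis using assms(2) A by auto
next
  case (B w s c)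
  have v: "w > 0" "s > 0" and E: "\<And>E. E \<in> sets borel \<Longrightarrow> E \<subseteq> {0<..<\<beta>} \<Longrightarrow>
     prob (aff c s ` E) = w * prob E"
    using assms(1) B by auto
  have "good (B (w * p1) (s * \<rho>) c)"
  proof -
    have "prob (aff c (s * \<rho>) ` E) = w * p1 * prob E" if "E \<in> sets borel" "E \<subseteq> {0<..<\<beta>}" for E
    proof -
      have "S1 ` E \<subseteq> S1 ` {0<..<\<beta>}" using that(2) by auto
      also note S_images_subset(1)
      finally have "prob (aff c s ` (S1 ` E)) = w * (p1 * prob E)"
        using that ratios_nonzero by (simp add: E prob_S1 aff_image_borel)
      then show ?thesis by (simp add: aff_aff_image)
    qed
    then show ?thesis using v \<rho> p_pos by simp
  qed
  moreover have "good (A 1 w (s * r) (c + s * (\<rho> * (1 - r))))"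
  proof -
    have "prob (aff (c + s * (\<rho> * (1 - r))) (s * r) ` E) = w * (p2 * prob E + p1 * p3 * \<nu> E)"
      if "E \<in> sets borel" "E \<subseteq> J" for E
    proof -
      have "S2 ` E \<subseteq> S2 ` J" using that(2) by auto
      also note S_images_subset(3)
      finally have "prob (aff c s ` (S2 ` E)) = w * (p2 * prob E + p1 * p3 * \<nu> E)"
        using that ratios_nonzero by (simp add: E prob_S2 aff_image_borel)
      then show ?thesis by (simp add: aff_aff_image)
    qed
    then show ?thesis using v r by (simp add: algebra_simps)
  qed
  ultimately show ?thesis using assms(2) B by auto
qed

lemma prob_cell:
  "good (A k w s c) \<Longrightarrow> prob (cell (A k w s c)) = w * (p2 ^ k + (P k - p1 * p2 ^ k))"
  "good (B w s c) \<Longrightarrow> prob (cell (B w s c)) = w * (p1 + p2)"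
  by (simp_all add: cell_def prob_J \<nu>_J prob_\<beta>)

lemma prob_cell_pos: "good v \<Longrightarrow> prob (cell v) > 0"
proof (cases v)
  case (A k w s c)
  assume "good v"
  then show ?thesis using P_lower[of k] p_pos unfolding A
    by (subst prob_cell) (auto intro!: mult_pos_pos add_pos_nonneg)
next
  case (B w s c)
  assume "good v"
  then show ?thesis using p_pos unfolding B by (subst prob_cell) auto
qed

lemma finite_kids: "finite (kids v)"
  by (cases v) auto

lemma sum_prob_kids:
  assumes "good v"
  shows "(\<Sum>u\<in>kids v. prob (cell u)) = prob (cell v)"
proof -
  note g = good_kids[OF assms]
  show ?thesis
  proof (cases v)
    case (A k w s c)
    have p: "1 - p3 = p1 + p2" using p_sum by simp
    have "(\<Sum>u\<in>kids v. prob (cell u)) = w * P k * (1 - p3) + (w * (p2 ^ Suc k + (P (Suc k) - p1 * p2 ^ Suc k))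
        + w * p2 ^ k * p3 * (p2 ^ 0 + (P 0 - p1 * p2 ^ 0)))"
      using g unfolding A p by (simp add: prob_cell del: good.simps block_weight.simps power.simps)
    also have "\<dots> = w * (p2 ^ k * (p2 + p3) + P k)" by (simp add: algebra_simps)
    also have "p2 + p3 = 1 - p1" using p_sum by simp
    also have "w * (p2 ^ k * (1 - p1) + P k) = prob (cell v)"
      using assms unfolding A by (subst prob_cell) (auto simp: algebra_simps)
    finally show ?thesis .
  next
    case (B w s c)
    have "(\<Sum>u\<in>kids v. prob (cell u)) = w * p1 * (p1 + p2) + w * (p2 ^ 1 + (P 1 - p1 * p2 ^ 1))"
      using g unfolding B by (simp add: prob_cell del: good.simps block_weight.simps power.simps)
    also have "\<dots> = w * (p1 * (p1 + p2 + p3) + p2)" by (simp add: algebra_simps)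
    also have "\<dots> = prob (cell v)"
      using assms unfolding B by (subst prob_cell) (auto simp: p_sum)
    finally show ?thesis .
  qed
qed

text \<open>For \<open>A\<close> this is the recursion of \<open>tail_energy\<close>. For
  \<open>B\<close> it is the second row of the eigenvector equation: the recursion at 0 without the
  term \<open>Y\<close> of the missing letter 3.\<close>

lemma sum_energy_kids:
  assumes "good v"
  shows "(\<Sum>u\<in>kids v. energy q u) = energy q v"
proof -
  define t where "t = crit q"
  define y where "y = Y q t"
  have r1: "r powr (- t) * r powr t = 1" "(r ^ k) powr (- t) * (r ^ k) powr t = 1"
    "(r ^ k) powr t * (r ^ k) powr (- t) = 1" for k
    using r by (simp_all flip: powr_add)
  show ?thesis
  proof (cases v)
    case (A k w s c)
    have ws: "w > 0" "s > 0" using assms A by auto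
    have b: "energy q (B (w * P k) (s * \<rho>) c)
      = w powr q * s powr (- t) * (r ^ k) powr t * (block_term q t k * (1 - y))"
      using ws \<rho> r r1(3)[of k]
      by (simp add: t_def[symmetric] y_def[symmetric] powr_mult block_term_def)
    have a: "energy q (A (Suc k) w (s * r) c') = w powr q * s powr (- t) * (r ^ k) powr t * tail_energy q (Suc k)" for c'
      using ws r r1(1) by (simp add: t_def[symmetric] powr_mult)
    have a0: "energy q (A 0 (w * p2 ^ k * p3) (s * r) c')
      = w powr q * s powr (- t) * (r ^ k) powr t * (X q t ^ k * y)" for c'
      using ws r r1(3)[of k] p_pos
      by (simp add: t_def[symmetric] y_def Y_def powr_mult tail_energy_0 X_power)
    have "(\<Sum>u\<in>kids v. energy q u) = w powr q * s powr (- t) * (r ^ k) powr t * (block_term q t k * (1 - y))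
      + (w powr q * s powr (- t) * (r ^ k) powr t * tail_energy q (Suc k)
      + w powr q * s powr (- t) * (r ^ k) powr t * (X q t ^ k * y))"
      unfolding A by (simp add: a a0 b del: energy.simps)
    also have "\<dots> = w powr q * s powr (- t) * (r ^ k) powr t *
       (block_term q t k * (1 - y) + X q t ^ k * y + tail_energy q (Suc k))"
      by (simp add: algebra_simps)
    also have "\<dots> = energy q v" unfolding A
      by (simp add: t_def[symmetric] y_def tail_energy_rec[of q k])
    finally show ?thesis .
  next
    case (B w s c)
    have ws: "w > 0" "s > 0" using assms B by auto
    have b: "energy q (B (w * p1) (s * \<rho>) c) = w powr q * s powr (- t) * (block_term q t 0 * (1 - y))"
      using ws \<rho> r p_pos by (simp add: t_def[symmetric] y_def[symmetric] powr_mult block_term_def)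
    have a: "energy q (A 1 w (s * r) c') = w powr q * s powr (- t) * tail_energy q 1" for c'
      using ws r r1(1) by (simp add: t_def[symmetric] powr_mult)
    have "(\<Sum>u\<in>kids v. energy q u) = w powr q * s powr (- t) * (block_term q t 0 * (1 - y) + tail_energy q 1)"
      unfolding B by (simp add: a b distrib_left del: energy.simps One_nat_def)
    also have "block_term q t 0 * (1 - y) + tail_energy q 1 = 1 - y"
      using tail_energy_rec[of q 0] by (simp add: t_def[symmetric] y_def tail_energy_0)
    finally show ?thesis unfolding B by (simp add: t_def[symmetric] y_def)
  qed
qed

lemma cell_kids_subset:
  assumes "good v" "u \<in> kids v"
  shows "cell u \<subseteq> cell v"
proof (cases v)
  case (A k w s c)
  have "cell u = aff c s ` (S1 ` {0<..<\<beta>}) \<or> cell u = aff c s ` (S2 ` J) \<or> cell u = aff c s ` (S3 ` J)"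
    using assms(2) unfolding A kids.simps insert_iff empty_iff
    by (elim disjE FalseE) (simp_all only: cell_kids simp_thms)
  then show ?thesis
    unfolding A cell_def[of "A k w s c"] core.simps offset.simps scale.simps using S_images_subset by (metis image_mono)
next
  case (B w s c)
  have "cell u = aff c s ` (S1 ` {0<..<\<beta>}) \<or> cell u = aff c s ` (S2 ` J)"
    using assms(2) unfolding B kids.simps insert_iff empty_iff
    by (elim disjE FalseE) (simp_all only: cell_kids simp_thms)
  then show ?thesis
    unfolding B cell_def[of "B w s c"] core.simps offset.simps scale.simps using S_images_subset by (metis image_mono)
qed

lemma disjoint_cell_kids:
  assumes "good v"
  shows "disjoint_family_on cell (kids v)"
proof -
  have "{0<..<\<rho> * (1 - r)} \<inter> S2 ` J = {}" "{0<..<\<rho> * (1 - r)} \<inter> S3 ` J = {}"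
    and 23: "S2 ` J \<inter> S3 ` J = {}"
    unfolding S_images(2,3) using \<beta>(2,6) \<rho> r by auto
  then have 12: "S1 ` {0<..<\<beta>} \<inter> S2 ` J = {}" and 13: "S1 ` {0<..<\<beta>} \<inter> S3 ` J = {}"
    using S_images(1) by blast+
  have aff_disjoint: "aff c s ` U \<inter> aff c s ` V = {}" if "s > 0" "U \<inter> V = {}" for c s U V
    using that inj_aff[of s c] by (metis image_Int image_empty less_irrefl)
  have e: "aff c s ` (S1 ` {0<..<\<beta>}) \<inter> aff c s ` (S2 ` J) = {}"
    "aff c s ` (S1 ` {0<..<\<beta>}) \<inter> aff c s ` (S3 ` J) = {}"
    "aff c s ` (S2 ` J) \<inter> aff c s ` (S3 ` J) = {}" if "s > 0" for c s
    by (intro aff_disjoint that 12 13 23)+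
  show ?thesis
  proof (cases v)
    case (A k w s c)
    then have s: "s > 0" using good_scale[OF assms] by simp
    have "cell (B (w * P k) (s * \<rho>) c) \<inter> cell (A (Suc k) w (s * r) (c + s * (\<rho> * (1 - r)))) = {}"
      "cell (B (w * P k) (s * \<rho>) c) \<inter> cell (A 0 (w * p2 ^ k * p3) (s * r) (c + s * (1 - r))) = {}"
      "cell (A (Suc k) w (s * r) (c + s * (\<rho> * (1 - r)))) \<inter> cell (A 0 (w * p2 ^ k * p3) (s * r) (c + s * (1 - r))) = {}"
      unfolding cell_kids using e[OF s] by simp_all
    then show ?thesis
      unfolding A disjoint_family_on_def kids.simps by blast
  next
    case (B w s c)
    then have s: "s > 0" using good_scale[OF assms] by simp
    have "cell (B (w * p1) (s * \<rho>) c) \<inter> cell (A 1 w (s * r) (c + s * (\<rho> * (1 - r)))) = {}"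
      unfolding cell_kids using e[OF s] by simp
    then show ?thesis
      unfolding B disjoint_family_on_def kids.simps by blast
  qed
qed

lemma scale_kids:
  assumes "good v" "u \<in> kids v"
  shows "min \<rho> r * scale v \<le> scale u" "scale u \<le> max \<rho> r * scale v"
  using assms by (cases v; auto simp: mult.commute intro!: mult_right_mono)+

end

section \<open>Cutting at a given scale\<close>

text \<open>Comparison of total length, applied to the cells that meet a ball and to the balls
  assigned to one cell.\<close>

lemma card_disjoint_intervals_le:
  fixes I :: "'i \<Rightarrow> real set"
  assumes "finite F" "disjoint_family_on I F" "a \<le> b"
    and I: "\<And>i. i \<in> F \<Longrightarrow> I i \<in> sets borel" "\<And>i. i \<in> F \<Longrightarrow> I i \<subseteq> {a..b}"
      "\<And>i. i \<in> F \<Longrightarrow> d \<le> measure lborel (I i)"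
  shows "real (card F) * d \<le> b - a"
proof -
  have fm: "I i \<in> fmeasurable lborel" if "i \<in> F" for i
    using that I by (intro fmeasurableI2[OF fmeasurable_compact[of "{a..b}"]]) auto
  have "real (card F) * d = (\<Sum>i\<in>F. d)" by simp
  also have "\<dots> \<le> (\<Sum>i\<in>F. measure lborel (I i))" using I by (intro sum_mono)
  also have "\<dots> = measure lborel (\<Union>i\<in>F. I i)"
    using assms(1,2) fm
    by (intro measure_UNION'[symmetric]) (auto simp: pairwise_def disjoint_family_on_def disjnt_def)
  also have "\<dots> \<le> measure lborel {a..b}"
    using I assms(1) by (intro measure_mono_fmeasurable[OF _ _ fmeasurable_compact]) auto
  also have "\<dots> = b - a" using assms(3) by simp
  finally show ?thesis .
qed

lemma powr_scale_between:
  fixes m T s t :: real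
  assumes "0 < m" "0 < T" "m * T \<le> s" "s \<le> T"
  shows "min (m powr t) 1 * T powr t \<le> s powr t" "s powr t \<le> max (m powr t) 1 * T powr t"
proof -
  have "(m * T) powr t = m powr t * T powr t" using assms by (simp add: powr_mult)
  then show "min (m powr t) 1 * T powr t \<le> s powr t" "s powr t \<le> max (m powr t) 1 * T powr t"
    using powr_between[of "m * T" s T t] assms
    by (auto simp: min_mult_distrib_right max_mult_distrib_right)
qed

text \<open>Otherwise \<open>U\<close> would be covered by open null sets, countably many of them by
  Lindelof. This supplies the base point for the lower bound of the moment sums.\<close>

lemma msupport_meets_open:
  assumes sets: "sets \<mu> = sets borel" and U: "open U" "emeasure \<mu> U > 0"
  shows "\<exists>x. x \<in> U \<and> x \<in> msupport \<mu>"
proof (rule ccontr)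
  assume no: "\<not> ?thesis"
  have "\<exists>V. open V \<and> x \<in> V \<and> emeasure \<mu> V = 0" if x: "x \<in> U" for x
  proof -
    have "x \<notin> msupport \<mu>" using no x by blast
    then show ?thesis unfolding msupport_def using zero_less_iff_neq_zero by blast
  qed
  then obtain V where V: "\<And>x. x \<in> U \<Longrightarrow> open (V x) \<and> x \<in> V x \<and> emeasure \<mu> (V x) = 0"
    by metis
  obtain F where F: "F \<subseteq> V ` U" "countable F" "\<Union>F = \<Union>(V ` U)"
    using Lindelof[of "V ` U"] V by blast
  have "(\<Union>W\<in>F. W) \<in> null_sets \<mu>"
    using F(1,2) V sets by (intro null_sets_UN') (auto simp: null_sets_def)
  moreover have "U \<subseteq> (\<Union>W\<in>F. W)" using V F(3) by fastforce
  ultimately have "U \<in> null_sets \<mu>"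
    using U(1) sets by (metis borel_open null_sets_subset)
  then show False using U(2) by auto
qed

lemma closed_msupport: "closed (msupport \<mu>)"
proof -
  have "open (- msupport \<mu>)"
  proof (rule topological_space_class.openI)
    fix x assume "x \<in> - msupport \<mu>"
    then obtain U where U: "open U" "x \<in> U" "\<not> emeasure \<mu> U > 0"
      unfolding msupport_def mem_Collect_eq Compl_iff by metis
    have "U \<subseteq> - msupport \<mu>"
    proof (intro subsetI ComplI)
      fix y assume "y \<in> U" "y \<in> msupport \<mu>"
      then have "emeasure \<mu> U > 0" using U(1) by (simp add: msupport_def)
      with U(3) show False by (rule notE)
    qed
    with U(1,2) show "\<exists>U. open U \<and> x \<in> U \<and> U \<subseteq> - msupport \<mu>" by (intro exI conjI)
  qed
  then show ?thesis by (simp add: closed_def)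
qed

context overlap_measure
begin

section \<open>Energy of a cell against its mass and size\<close>

definition width :: "node \<Rightarrow> real" where
  "width v = scale v * (case v of A k w s c \<Rightarrow> 1 | B w s c \<Rightarrow> \<beta>)"

lemma cell_eq: "good v \<Longrightarrow> cell v = {offset v<..<offset v + width v}"
  by (cases v) (simp_all add: cell_def width_def aff_image_greaterThanLessThan)

lemma width: "good v \<Longrightarrow> \<beta> * scale v \<le> width v" "good v \<Longrightarrow> width v \<le> scale v"
  using \<beta> by (cases v; simp add: width_def mult.commute)+

text \<open>For a run of \<open>k\<close> twos, \<open>(r ^ k) powr crit q\<close> is
  \<open>(p2 ^ k) powr q / X ^ k\<close>. The power of \<open>X\<close> cancels against
  \<open>tail_energy\<close>, and the power of \<open>p2\<close> is the one in the mass of the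
  cell.\<close>

lemma energy_comparable:
  obtains c C where "c > 0" "C > 0"
    "\<And>v. good v \<Longrightarrow> c * (prob (cell v) powr q * scale v powr (- crit q)) \<le> energy q v"
    "\<And>v. good v \<Longrightarrow> energy q v \<le> C * (prob (cell v) powr q * scale v powr (- crit q))"
proof -
  define t where "t = crit q"
  define x where "x = X q t"
  obtain d D where dD: "d > 0" "D > 0" "\<And>k. d * x ^ k \<le> tail_energy q k" "\<And>k. tail_energy q k \<le> D * x ^ k"
    using tail_energy_bounds[of q] unfolding x_def t_def by metis
  define y where "y = Y q t"
  have y: "y < 1" using crit[of q] by (simp add: y_def t_def)
  define m where "m = min 1 ((1 + \<kappa>) powr q)"
  define M where "M = max 1 ((1 + \<kappa>) powr q)"
  have mM: "m > 0" "M > 0" using \<kappa>_pos by (auto simp: m_def M_def less_max_iff_disj)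
  define b where "b = (1 - y) / (p1 + p2) powr q"
  have b: "b > 0" using y p_pos by (simp add: b_def)
  have main: "\<exists>\<theta>. (\<theta> = b \<or> d / M \<le> \<theta> \<and> \<theta> \<le> D / m) \<and>
      energy q v = \<theta> * (prob (cell v) powr q * scale v powr (- t))" if g: "good v" for v
  proof (cases v)
    case (A k w s c)
    have ws: "w > 0" "s > 0" using g A by auto
    \<comment> \<open>The mass of the cell is \<open>w * p2 ^ k * h\<close>, so \<open>h\<close>
      measures its distortion through the overlap; it stays between 1 and
      \<open>1 + \<kappa>\<close> for all \<open>k\<close>.\<close>
    define h where "h = 1 + (P k / p2 ^ k - p1)"
    have h: "1 \<le> h" "h \<le> 1 + \<kappa>"
      using P_lower[of k] P_upper[of k] p_pos by (auto simp: h_def field_simps)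
        (smt (verit) mult_pos_pos zero_less_power)
    have hq: "m \<le> h powr q" "h powr q \<le> M" "h powr q > 0"
      using powr_between[of 1 h "1 + \<kappa>" q] h by (auto simp: m_def M_def)
    have "p2 ^ k * h = p2 ^ k + (P k - p1 * p2 ^ k)" using p_pos by (simp add: h_def field_simps)
    then have "prob (cell v) = w * p2 ^ k * h" using g unfolding A by (simp add: prob_cell del: good.simps)
    then have pq: "prob (cell v) powr q = w powr q * (p2 ^ k) powr q * h powr q"
      using ws h p_pos by (simp add: powr_mult)
    have xk: "x ^ k > 0" by (simp add: x_def)
    have "x ^ k * (r ^ k) powr t = (p2 ^ k) powr q"
      using r by (simp add: x_def X_power mult.assoc flip: powr_add)
    then have rk: "(r ^ k) powr t = (p2 ^ k) powr q / x ^ k"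
      using xk by (metis less_irrefl nonzero_mult_div_cancel_left)
    define e where "e = tail_energy q k / x ^ k"
    have e: "d \<le> e" "e \<le> D"
      using dD(3,4)[of k] xk by (simp_all add: e_def field_simps)
    define \<theta> where "\<theta> = e / h powr q"
    have "d / M \<le> \<theta>" "\<theta> \<le> D / m"
      unfolding \<theta>_def by (rule frac_le; use e hq mM dD(1,2) in linarith)+
    moreover have "energy q v = \<theta> * (prob (cell v) powr q * scale v powr (- t))"
      unfolding pq unfolding A using xk hq by (simp add: \<theta>_def e_def rk flip: t_def)
    ultimately show ?thesis by blast
  next
    case (B w s c)
    have ws: "w > 0" "s > 0" using g B by auto
    have "prob (cell v) powr q = w powr q * (p1 + p2) powr q"
      using g ws p_pos unfolding B by (simp add: prob_cell powr_mult del: good.simps)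
    then have "energy q v = b * (prob (cell v) powr q * scale v powr (- t))"
      using p_pos unfolding B by (simp add: b_def y_def flip: t_def)
    then show ?thesis by blast
  qed
  show ?thesis
  proof (rule that[of "min (d / M) b" "max (D / m) b"])
    show "min (d / M) b > 0" "max (D / m) b > 0" using dD mM b by auto
    fix v assume g: "good v"
    have N: "0 \<le> prob (cell v) powr q * scale v powr (- t)" by simp
    show "min (d / M) b * (prob (cell v) powr q * scale v powr (- crit q)) \<le> energy q v"
      "energy q v \<le> max (D / m) b * (prob (cell v) powr q * scale v powr (- crit q))"
      using main[OF g] unfolding t_def[symmetric] by (auto intro!: mult_right_mono[OF _ N])
  qed
qed

text \<open>Cells are open and may leave gaps, so covering is replaced by conservation of mass. The
  conserved sums belong to the definition in order to pass through the recursion, with one cut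
  serving all \<open>q\<close>.\<close>

definition cut :: "real \<Rightarrow> node \<Rightarrow> node set \<Rightarrow> bool" where
  "cut T v C \<longleftrightarrow> finite C \<and> disjoint_family_on cell C \<and>
    (\<forall>u\<in>C. good u \<and> min \<rho> r * T \<le> scale u \<and> scale u \<le> T \<and> cell u \<subseteq> cell v) \<and>
    (\<Sum>u\<in>C. prob (cell u)) = prob (cell v) \<and> (\<forall>q. (\<Sum>u\<in>C. energy q u) = energy q v)"

lemma cut_UN:
  assumes v: "good v" and D: "\<And>u. u \<in> kids v \<Longrightarrow> cut T u (D u)"
  shows "cut T v (\<Union>u\<in>kids v. D u)"
proof -
  have dis: "disjoint_family_on cell (kids v)" by (rule disjoint_cell_kids[OF v])
  have sub: "cell a \<subseteq> cell u" "good a" if "u \<in> kids v" "a \<in> D u" for u a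
    using D[OF that(1)] that(2) by (auto simp: cut_def)
  \<comment> \<open>Nodes are plain data, so two children might share a descendant and the union
    would count it once. Disjointness of the children's cells and positive mass of every cell
    exclude this.\<close>
  have disD: "D u \<inter> D u' = {}" if "u \<in> kids v" "u' \<in> kids v" "u \<noteq> u'" for u u'
  proof (rule ccontr)
    assume "D u \<inter> D u' \<noteq> {}"
    then obtain a where a: "a \<in> D u" "a \<in> D u'" by blast
    then have "cell a \<subseteq> cell u \<inter> cell u'" using sub that by blast
    also have "\<dots> = {}" using dis that by (auto simp: disjoint_family_on_def)
    finally show False using prob_cell_pos[OF sub(2)[OF that(1) a(1)]] by simp
  qed
  have sum: "sum f (\<Union>u\<in>kids v. D u) = (\<Sum>u\<in>kids v. sum f (D u))" for f :: "node \<Rightarrow> real"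
    using D disD finite_kids by (intro sum.UNION_disjoint) (auto simp: cut_def)
  have "cell a \<inter> cell b = {}" if "a \<in> D u" "b \<in> D u'" "u \<in> kids v" "u' \<in> kids v" "a \<noteq> b" for a b u u'
  proof (cases "u = u'")
    case True
    then show ?thesis using that D[of u] by (auto simp: cut_def disjoint_family_on_def)
  next
    case False
    then have "cell u \<inter> cell u' = {}" using dis that by (auto simp: disjoint_family_on_def)
    then show ?thesis using sub that by blast
  qed
  then have "disjoint_family_on cell (\<Union>u\<in>kids v. D u)"
    unfolding disjoint_family_on_def by blast
  moreover have "(\<Sum>u\<in>(\<Union>u\<in>kids v. D u). prob (cell u)) = prob (cell v)"
    using D sum_prob_kids[OF v] unfolding sum by (simp add: cut_def)
  moreover have "(\<Sum>u\<in>(\<Union>u\<in>kids v. D u). energy q u) = energy q v" for q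
    using D sum_energy_kids[OF v, of q] unfolding sum by (simp add: cut_def)
  moreover have "good a \<and> min \<rho> r * T \<le> scale a \<and> scale a \<le> T \<and> cell a \<subseteq> cell v"
    if "u \<in> kids v" "a \<in> D u" for u a
    using D[OF that(1)] that cell_kids_subset[OF v that(1)] by (auto simp: cut_def)
  ultimately show ?thesis
    using D finite_kids unfolding cut_def by blast
qed

text \<open>Subdivision stops as soon as the scale is at most \<open>T\<close>. The parent was still
  above \<open>T\<close>, which gives the lower bound \<open>min \<rho> r * T\<close>; scales shrink
  at least by \<open>c\<close> per step, so the process ends.\<close>

lemma ex_cut:
  assumes "good v" "0 < T" "T < scale v"
  shows "\<exists>C. cut T v C"
proof -
  define c where "c = max \<rho> r"
  have c: "0 < c" "c < 1" using \<rho> r by (auto simp: c_def)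
  have "\<exists>C. cut T v C" if "good v" "T < scale v" "scale v * c ^ n \<le> T" for n v
    using that
  proof (induction n arbitrary: v)
    case (Suc n)
    have "\<exists>D. cut T u D" if u: "u \<in> kids v" for u
    proof (cases "scale u \<le> T")
      case True
      have "min \<rho> r * T \<le> min \<rho> r * scale v" using Suc.prems(2) \<rho> r by (intro mult_left_mono) auto
      also have "\<dots> \<le> scale u" using scale_kids[OF Suc.prems(1) u] by simp
      finally have "cut T u {u}"
        using True good_kids[OF Suc.prems(1) u] by (auto simp: cut_def disjoint_family_on_def)
      then show ?thesis by blast
    next
      case False
      have "scale u * c ^ n \<le> (c * scale v) * c ^ n"
        using scale_kids[OF Suc.prems(1) u] c by (intro mult_right_mono) (auto simp: c_def)
      also have "\<dots> \<le> T" using Suc.prems(3) by (simp add: mult_ac)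
      finally show ?thesis using False good_kids[OF Suc.prems(1) u] by (intro Suc.IH) auto
    qed
    then obtain D where "\<And>u. u \<in> kids v \<Longrightarrow> cut T u (D u)" by metis
    then show ?case using cut_UN[OF Suc.prems(1)] by blast
  qed simp
  moreover obtain n where "c ^ n < T / scale v"
    using real_arch_pow_inv[of "T / scale v" c] c assms by auto
  then have "scale v * c ^ n \<le> T" using assms by (simp add: field_simps)
  ultimately show ?thesis using assms by blast
qed

definition root :: node where "root = A 0 1 1 0"

lemma root: "good root" "scale root = 1" "cell root = J" "energy q root = 1" "prob (cell root) = 1"
proof -
  have [simp]: "aff 0 1 = id" by (auto simp: aff_def)
  show "good root" "scale root = 1" "cell root = J" "energy q root = 1"
    by (simp_all add: root_def cell_def tail_energy_0)
  then show "prob (cell root) = 1" by (simp add: prob_J)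
qed

lemma ex_root_cut: "0 < T \<Longrightarrow> T < 1 \<Longrightarrow> \<exists>C. cut T root C"
  using ex_cut root by simp

lemma cell_borel: "good v \<Longrightarrow> cell v \<in> sets borel"
  by (simp add: cell_eq)

lemma prob_UN_cut:
  assumes "cut T root C"
  shows "prob (\<Union>u\<in>C. cell u) = 1"
proof -
  have "prob (\<Union>u\<in>C. cell u) = (\<Sum>u\<in>C. prob (cell u))"
    using assms by (intro finite_measure_finite_Union) (auto simp: cut_def cell_borel)
  then show ?thesis using assms root(5) by (simp add: cut_def)
qed

lemma msupport_subset: "msupport \<mu> \<subseteq> {0..1}"
proof
  fix x assume x: "x \<in> msupport \<mu>"
  have "prob (- {0..1}) = 0" by (intro prob_outside) auto
  moreover have "open (- {0..1::real})" by (simp add: open_Compl)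
  ultimately show "x \<in> {0..1}"
    using x by (auto simp: msupport_def emeasure_eq_measure dest!: spec[of _ "- {0..1}"])
qed

lemma compact_msupport: "compact (msupport \<mu>)"
  using closed_msupport msupport_subset by (metis bounded_closed_interval bounded_subset compact_eq_bounded_closed)

lemma prob_open_pos: "x \<in> msupport \<mu> \<Longrightarrow> open U \<Longrightarrow> x \<in> U \<Longrightarrow> prob U > 0"
  by (auto simp: msupport_def emeasure_eq_measure)

text \<open>The cells of a cut carry full mass, so the complement of the finitely many closed cells
  is an open null set.\<close>

lemma msupport_closed_cell:
  assumes C: "cut T root C" and x: "x \<in> msupport \<mu>"
  shows "\<exists>u\<in>C. x \<in> {offset u..offset u + width u}"
proof (rule ccontr)
  assume *: "\<not> ?thesis"
  define V where "V = - (\<Union>u\<in>C. {offset u..offset u + width u})"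
  have "open V" unfolding V_def using C by (intro open_Compl closed_UN) (auto simp: cut_def)
  moreover have "x \<in> V" using * by (auto simp: V_def)
  ultimately have pos: "prob V > 0" using prob_open_pos x by blast
  have "V \<inter> (\<Union>u\<in>C. cell u) = {}"
    using C by (auto simp: V_def cut_def cell_eq) (meson greaterThanLessThan_iff less_imp_le)+
  then have "prob (V \<union> (\<Union>u\<in>C. cell u)) = prob V + prob (\<Union>u\<in>C. cell u)"
    using \<open>open V\<close> C by (intro finite_measure_Union sets.finite_UN) (auto simp: cut_def cell_borel)
  then show False using pos prob_UN_cut[OF C] prob_le_1[of "V \<union> (\<Union>u\<in>C. cell u)"] by simp
qed

text \<open>Bounded distortion: the \<open>\<nu>\<close> part is dropped from the mass of the image
  and costs at most the factor \<open>1 + \<kappa>\<close> in the mass of the cell.\<close>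

lemma prob_aff_lower:
  assumes "good v" "E \<in> sets borel" "E \<subseteq> {0<..<\<beta>}"
  shows "prob (cell v) * prob E / (1 + \<kappa>) \<le> prob (aff (offset v) (scale v) ` E)"
proof (cases v)
  case (A k w s c)
  have w: "w > 0" using assms A by simp
  have E: "E \<subseteq> J" using assms(3) \<beta> by auto
  have k: "0 \<le> P k - p1 * p2 ^ k" "P k - p1 * p2 ^ k \<le> \<kappa> * p2 ^ k"
  proof -
    have "0 \<le> p1 * p2 ^ k" using p_pos by simp
    then show "0 \<le> P k - p1 * p2 ^ k" "P k - p1 * p2 ^ k \<le> \<kappa> * p2 ^ k"
      using P_lower[of k] P_upper[of k] by linarith+
  qed
  have "prob (cell v) = w * (p2 ^ k + (P k - p1 * p2 ^ k))"
    using assms(1) unfolding A by (intro prob_cell)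
  also have "\<dots> \<le> w * (p2 ^ k + \<kappa> * p2 ^ k)" using k w by (intro mult_left_mono) auto
  finally have "prob (cell v) / (1 + \<kappa>) \<le> w * p2 ^ k"
    using \<kappa>_pos by (simp add: pos_divide_le_eq algebra_simps)
  then have "prob (cell v) / (1 + \<kappa>) * prob E \<le> w * p2 ^ k * prob E" by (intro mult_right_mono) auto
  also have "\<dots> \<le> w * (p2 ^ k * prob E + (P k - p1 * p2 ^ k) * \<nu> E)"
    using w mult_nonneg_nonneg[OF k(1) \<nu>_nonneg[of E]] by (simp add: mult.assoc)
  also have "\<dots> = prob (aff (offset v) (scale v) ` E)" using assms E A by simp
  finally show ?thesis by simp
next
  case (B w s c)
  have w: "w > 0" using assms B by simp
  have "prob (cell v) = w * (p1 + p2)" using assms(1) unfolding B by (intro prob_cell)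
  also have "\<dots> \<le> w * (1 + \<kappa>)" using w p_pos p_sum \<kappa>_pos by (intro mult_left_mono) auto
  finally have "prob (cell v) / (1 + \<kappa>) \<le> w" using \<kappa>_pos by (simp add: pos_divide_le_eq)
  then have "prob (cell v) / (1 + \<kappa>) * prob E \<le> w * prob E" by (intro mult_right_mono) auto
  then show ?thesis using assms B by simp
qed

end

section \<open>The moment sums\<close>

lemma tendsto_ln_ratio:
  fixes M :: "real \<Rightarrow> real"
  assumes "c > 0" "C > 0" "t0 > 0"
    and bounds: "\<And>t. 0 < t \<Longrightarrow> t < t0 \<Longrightarrow> c * t powr a \<le> M t \<and> M t \<le> C * t powr a"
  shows "((\<lambda>t. ln (M t) / ln t) \<longlongrightarrow> a) (at_right 0)"
proof (rule tendsto_sandwich)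
  have small: "\<forall>\<^sub>F t in at_right 0. 0 < t \<and> t < min 1 t0"
    using assms(3) eventually_at_right_real[of 0 "min 1 t0"] by auto
  have *: "ln C / ln t + a \<le> ln (M t) / ln t \<and> ln (M t) / ln t \<le> ln c / ln t + a"
    if t: "0 < t \<and> t < min 1 t0" for t
  proof -
    have b: "c * t powr a \<le> M t" "M t \<le> C * t powr a" using bounds[of t] t by auto
    have pos: "0 < c * t powr a" "0 < C * t powr a" using assms t by auto
    have "ln (c * t powr a) \<le> ln (M t)" "ln (M t) \<le> ln (C * t powr a)"
      using b pos by auto
    then have "ln c + a * ln t \<le> ln (M t)" "ln (M t) \<le> ln C + a * ln t"
      using assms t by (simp_all add: ln_mult ln_powr)
    moreover have "ln t < 0" using t by simp
    ultimately have "(ln C + a * ln t) / ln t \<le> ln (M t) / ln t" "ln (M t) / ln t \<le> (ln c + a * ln t) / ln t"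
      by (auto intro!: divide_right_mono_neg)
    then show ?thesis using \<open>ln t < 0\<close> by (simp add: add_divide_distrib)
  qed
  show "\<forall>\<^sub>F t in at_right 0. ln C / ln t + a \<le> ln (M t) / ln t"
    "\<forall>\<^sub>F t in at_right 0. ln (M t) / ln t \<le> ln c / ln t + a"
    using * by (auto intro: eventually_mono[OF small])
  have lim: "((\<lambda>t::real. K / ln t + a) \<longlongrightarrow> 0 + a) (at_right 0)" for K
    by (intro tendsto_add tendsto_divide_0[OF tendsto_const] tendsto_const
        filterlim_at_bot_imp_at_infinity ln_at_0)
  show "((\<lambda>t. ln C / ln t + a) \<longlongrightarrow> a) (at_right 0)" "((\<lambda>t. ln c / ln t + a) \<longlongrightarrow> a) (at_right 0)"
    using lim by simp_all
qed

context overlap_measure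
begin

abbreviation m :: real where "m \<equiv> min \<rho> r"

lemma m: "0 < m" "m \<le> 1"
  using \<rho> r by auto

lemma cutD:
  assumes "cut T v C" "u \<in> C"
  shows "good u" "m * T \<le> scale u" "scale u \<le> T"
  using assms by (auto simp: cut_def)

text \<open>The cells meeting the ball are disjoint intervals of length at least
  \<open>\<beta> * m * t\<close> inside an interval of length \<open>4 * t\<close>. Their number is
  bounded, and the heaviest one dominates.\<close>

lemma prob_cball_le_max_cell:
  assumes C: "cut t root C" and t: "0 < t" and x: "x \<in> msupport \<mu>"
  shows "\<exists>v\<in>C. cell v \<inter> cball x t \<noteq> {} \<and> prob (cball x t) \<le> 4 / (\<beta> * m) * prob (cell v)"
proof -
  define N where "N = {v \<in> C. cell v \<inter> cball x t \<noteq> {}}"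
  define U where "U = (\<Union>u\<in>C. cell u)"
  have fin: "finite C" "finite N" using C by (auto simp: N_def cut_def)
  have U: "U \<in> sets borel" unfolding U_def using cutD(1)[OF C] fin by (intro sets.finite_UN cell_borel)
  have N: "good v" "v \<in> C" if "v \<in> N" for v using that cutD(1)[OF C] by (auto simp: N_def)
  have UN: "(\<Union>v\<in>N. cell v) \<in> sets borel" using fin N(1) by (intro sets.finite_UN cell_borel)
  have "cball x t \<subseteq> (\<Union>v\<in>N. cell v) \<union> (- U)" unfolding N_def U_def by blast
  then have "prob (cball x t) \<le> prob ((\<Union>v\<in>N. cell v) \<union> (- U))"
    using UN U by (intro finite_measure_mono) auto
  also have "\<dots> \<le> prob (\<Union>v\<in>N. cell v) + prob (- U)"
    using UN U by (intro measure_Un_le) auto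
  also have "prob (- U) = 0"
    using prob_compl[of U] U prob_UN_cut[OF C] by (simp add: U_def Compl_eq_Diff_UNIV)
  also have "prob (\<Union>v\<in>N. cell v) \<le> (\<Sum>v\<in>N. prob (cell v))"
    using fin N by (intro finite_measure_subadditive_finite) (auto intro!: cell_borel)
  finally have le: "prob (cball x t) \<le> (\<Sum>v\<in>N. prob (cell v))" by simp
  have "prob (ball x t) > 0" using t by (intro prob_open_pos[OF x]) auto
  also have "prob (ball x t) \<le> prob (cball x t)" by (intro finite_measure_mono) auto
  finally have "N \<noteq> {}" using le by auto
  define M where "M = Max ((\<lambda>v. prob (cell v)) ` N)"
  have "M \<in> (\<lambda>v. prob (cell v)) ` N" unfolding M_def using fin \<open>N \<noteq> {}\<close> by (intro Max_in) auto
  then obtain v where v: "v \<in> N" "M = prob (cell v)" by auto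
  have Mge: "prob (cell u) \<le> M" if "u \<in> N" for u
    unfolding M_def using that fin by (intro Max_ge) auto
  have "real (card N) * (\<beta> * m * t) \<le> (x + 2 * t) - (x - 2 * t)"
  proof (rule card_disjoint_intervals_le[where I = cell])
    show "disjoint_family_on cell N"
      using C by (auto simp: cut_def N_def disjoint_family_on_def)
    fix u assume u: "u \<in> N"
    note g = N(1)[OF u] and s = cutD[OF C N(2)[OF u]]
    show "cell u \<in> sets borel" using g by (rule cell_borel)
    have w: "width u \<le> t" "\<beta> * m * t \<le> width u" "width u \<ge> 0"
    proof -
      show "width u \<le> t" using width(2)[OF g] s(3) by linarith
      have "\<beta> * (m * t) \<le> \<beta> * scale u" using s(2) \<beta> by (intro mult_left_mono) auto
      then show 1: "\<beta> * m * t \<le> width u" using width(1)[OF g] by (simp add: mult.assoc)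
      have "0 \<le> \<beta> * m * t" using \<beta> m t by (intro mult_nonneg_nonneg) auto
      with 1 show "width u \<ge> 0" by linarith
    qed
    obtain y where y: "y \<in> cell u" "\<bar>x - y\<bar> \<le> t" using u by (auto simp: N_def dist_real_def)
    have "offset u < y" "y < offset u + width u" using y(1) by (auto simp: cell_eq[OF g])
    then show "cell u \<subseteq> {x - 2 * t..x + 2 * t}"
      using y(2) w(1) unfolding cell_eq[OF g] abs_le_iff by (intro subsetI) auto
    show "\<beta> * m * t \<le> measure lborel (cell u)" using w by (simp add: cell_eq[OF g])
  qed (use fin t in auto)
  then have "real (card N) \<le> 4 / (\<beta> * m)"
    using t \<beta> m by (simp add: field_simps)
  have "(\<Sum>v\<in>N. prob (cell v)) \<le> real (card N) * M" using Mge by (intro sum_bounded_above) auto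
  also have "\<dots> \<le> 4 / (\<beta> * m) * M"
    using \<open>real (card N) \<le> _\<close> v(2) by (intro mult_right_mono) auto
  finally show ?thesis using le v by (auto simp: N_def)
qed

text \<open>For \<open>q \<ge> 0\<close> the ball must be dominated by a cell, for
  \<open>q < 0\<close> it must contain one: the cell whose closure contains the centre has length at
  most \<open>t\<close>. The bound on the offset later limits how often a cell is chosen.\<close>

lemma prob_cball_powr_le:
  obtains K where "K > 0" "\<And>t C x. cut t root C \<Longrightarrow> 0 < t \<Longrightarrow> x \<in> msupport \<mu> \<Longrightarrow>
    \<exists>v\<in>C. \<bar>x - offset v\<bar> \<le> 2 * t \<and> prob (cball x t) powr q \<le> K * prob (cell v) powr q"
proof (cases "q \<ge> 0")
  case True
  define K where "K = 4 / (\<beta> * m)"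
  have K: "K > 0" using \<beta> m by (simp add: K_def)
  show ?thesis
  proof (rule that[of "K powr q"])
    show "K powr q > 0" using K by simp
    fix t C x assume C: "cut t root C" and t: "0 < t" and x: "x \<in> msupport \<mu>"
    then obtain v where v: "v \<in> C" "cell v \<inter> cball x t \<noteq> {}" "prob (cball x t) \<le> K * prob (cell v)"
      using prob_cball_le_max_cell unfolding K_def by blast
    note g = cutD[OF C v(1)]
    have "prob (cball x t) powr q \<le> (K * prob (cell v)) powr q"
      using True v(3) by (intro powr_mono2) auto
    then have "prob (cball x t) powr q \<le> K powr q * prob (cell v) powr q"
      using K by (simp add: powr_mult)
    moreover have "\<bar>x - offset v\<bar> \<le> 2 * t"
    proof -
      obtain y where "y \<in> cell v" "\<bar>x - y\<bar> \<le> t" using v(2) by (auto simp: dist_real_def)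
      then show ?thesis using width(2)[OF g(1)] g(3) by (auto simp: cell_eq[OF g(1)])
    qed
    ultimately show "\<exists>v\<in>C. \<bar>x - offset v\<bar> \<le> 2 * t \<and> prob (cball x t) powr q \<le> K powr q * prob (cell v) powr q"
      using v(1) by blast
  qed
next
  case False
  show ?thesis
  proof (rule that[of 1])
    fix t C x assume C: "cut t root C" and t: "0 < t" and x: "x \<in> msupport \<mu>"
    then obtain v where v: "v \<in> C" "x \<in> {offset v..offset v + width v}"
      using msupport_closed_cell by blast
    note g = cutD[OF C v(1)]
    have w: "width v \<le> t" using width(2)[OF g(1)] g(3) by linarith
    have "cell v \<subseteq> cball x t"
      using v(2) w unfolding cell_eq[OF g(1)] by (auto simp: dist_real_def)
    then have "prob (cell v) \<le> prob (cball x t)" by (intro finite_measure_mono) auto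
    then have "prob (cball x t) powr q \<le> prob (cell v) powr q"
      using False prob_cell_pos[OF g(1)] by (intro powr_mono2') auto
    moreover have "\<bar>x - offset v\<bar> \<le> 2 * t" using v(2) w by auto
    ultimately show "\<exists>v\<in>C. \<bar>x - offset v\<bar> \<le> 2 * t \<and> prob (cball x t) powr q \<le> 1 * prob (cell v) powr q"
      using v(1) by auto
  qed simp
qed

text \<open>Every ball of a packing is charged to a nearby cell of the cut at scale
  \<open>t\<close>. No cell is charged more than three times, and the energies of the cut add up to
  1.\<close>

lemma moment_sum_upper:
  obtains C0 where "C0 > 0" "\<And>t. 0 < t \<Longrightarrow> t < 1 \<Longrightarrow> moment_sum \<mu> q t \<le> C0 * t powr crit q"
proof -
  obtain K where K: "K > 0" "\<And>t C x. cut t root C \<Longrightarrow> 0 < t \<Longrightarrow> x \<in> msupport \<mu> \<Longrightarrow>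
    \<exists>v\<in>C. \<bar>x - offset v\<bar> \<le> 2 * t \<and> prob (cball x t) powr q \<le> K * prob (cell v) powr q"
    using prob_cball_powr_le[of q] by metis
  obtain c D where c: "c > 0" "D > 0"
    "\<And>v. good v \<Longrightarrow> c * (prob (cell v) powr q * scale v powr (- crit q)) \<le> energy q v"
    "\<And>v. good v \<Longrightarrow> energy q v \<le> D * (prob (cell v) powr q * scale v powr (- crit q))"
    using energy_comparable[of q] by metis
  define s0 where "s0 = max (m powr crit q) 1"
  have s0: "s0 > 0" by (simp add: s0_def less_max_iff_disj)
  have cell_le: "prob (cell v) powr q \<le> energy q v * (s0 * t powr crit q) / c"
    if "cut t root C" "v \<in> C" "0 < t" for t C v
  proof -
    note g = cutD[OF that(1,2)]
    have s: "scale v > 0" by (rule good_scale[OF g(1)])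
    have "prob (cell v) powr q = (prob (cell v) powr q * scale v powr (- crit q)) * scale v powr crit q"
      using s by (simp add: mult.assoc flip: powr_add)
    also have "\<dots> \<le> energy q v / c * scale v powr crit q"
      using c(3)[OF g(1)] c(1) by (intro mult_right_mono) (auto simp: field_simps)
    also have "\<dots> \<le> energy q v / c * (s0 * t powr crit q)"
    proof (rule mult_left_mono)
      show "scale v powr crit q \<le> s0 * t powr crit q"
        unfolding s0_def using powr_scale_between(2)[OF m(1) that(3) g(2,3)] .
      have "0 \<le> c * (prob (cell v) powr q * scale v powr (- crit q))" using c(1) by simp
      then have "0 \<le> energy q v" using c(3)[OF g(1)] by linarith
      then show "0 \<le> energy q v / c" using c(1) by simp
    qed
    finally show ?thesis by simp
  qed
  define C0 where "C0 = 3 * K * s0 / c"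
  have "moment_sum \<mu> q t \<le> C0 * t powr crit q" if t: "0 < t" "t < 1" for t
    unfolding moment_sum_def
  proof (rule cSUP_least)
    show "packings \<mu> t \<noteq> {}" by (auto simp: packings_def disjoint_family_on_def)
    fix F assume "F \<in> packings \<mu> t"
    then have F: "finite F" "F \<subseteq> msupport \<mu>" "disjoint_family_on (\<lambda>x. cball x t) F"
      by (auto simp: packings_def)
    obtain C where C: "cut t root C" using ex_root_cut[OF t] by blast
    have finC: "finite C" using C by (simp add: cut_def)
    have "\<forall>x\<in>F. \<exists>v. v \<in> C \<and> \<bar>x - offset v\<bar> \<le> 2 * t \<and> prob (cball x t) powr q \<le> K * prob (cell v) powr q"
      using K(2)[OF C t(1)] F(2) by blast
    then obtain f where f: "\<And>x. x \<in> F \<Longrightarrow> f x \<in> C"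
      "\<And>x. x \<in> F \<Longrightarrow> \<bar>x - offset (f x)\<bar> \<le> 2 * t"
      "\<And>x. x \<in> F \<Longrightarrow> prob (cball x t) powr q \<le> K * prob (cell (f x)) powr q"
      by metis
    \<comment> \<open>Disjoint balls of length \<open>2 * t\<close> with centres within
      \<open>2 * t\<close> of one point share an interval of length \<open>6 * t\<close>.\<close>
    have fiber: "real (card {x \<in> F. f x = v}) \<le> 3" for v
    proof -
      have "real (card {x \<in> F. f x = v}) * (2 * t) \<le> (offset v + 3 * t) - (offset v - 3 * t)"
      proof (rule card_disjoint_intervals_le[where I = "\<lambda>x. cball x t"])
        show "disjoint_family_on (\<lambda>x. cball x t) {x \<in> F. f x = v}"
          using F(3) by (auto simp: disjoint_family_on_def)
        fix x assume "x \<in> {x \<in> F. f x = v}"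
        then have "\<bar>x - offset v\<bar> \<le> 2 * t" using f(2) by auto
        then show "cball x t \<subseteq> {offset v - 3 * t..offset v + 3 * t}"
          unfolding cball_eq_atLeastAtMost by auto
        show "2 * t \<le> measure lborel (cball x t)"
          using t unfolding cball_eq_atLeastAtMost by simp
      qed (use F t in auto)
      then have "real (card {x \<in> F. f x = v}) * (2 * t) \<le> 3 * (2 * t)" by simp
      then show ?thesis using t by simp
    qed
    have "(\<Sum>x\<in>F. prob (cball x t) powr q) \<le> (\<Sum>x\<in>F. K * prob (cell (f x)) powr q)"
      using f by (intro sum_mono)
    also have "\<dots> = (\<Sum>v\<in>C. \<Sum>x\<in>{x \<in> F. f x = v}. K * prob (cell (f x)) powr q)"
      using F(1) finC f(1) by (intro sum.group[symmetric]) auto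
    also have "\<dots> = (\<Sum>v\<in>C. real (card {x \<in> F. f x = v}) * (K * prob (cell v) powr q))"
      by (intro sum.cong) auto
    also have "\<dots> \<le> (\<Sum>v\<in>C. 3 * (K * (energy q v * (s0 * t powr crit q) / c)))"
      using fiber K(1) cell_le[OF C _ t(1)] by (intro sum_mono mult_mono mult_left_mono) auto
    also have "\<dots> = (\<Sum>v\<in>C. C0 * t powr crit q * energy q v)"
      by (intro sum.cong) (auto simp: C0_def)
    also have "\<dots> = C0 * t powr crit q * (\<Sum>v\<in>C. energy q v)"
      by (simp add: sum_distrib_left)
    also have "(\<Sum>v\<in>C. energy q v) = 1"
      using C root(4)[of q] by (simp add: cut_def)
    finally show "(\<Sum>x\<in>F. prob (cball x t) powr q) \<le> C0 * t powr crit q" by simp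
  qed
  moreover have "C0 > 0" using K(1) s0 c(1) by (simp add: C0_def)
  ultimately show ?thesis using that by blast
qed

text \<open>One ball is placed well inside each cell of a cut, so the balls form a packing. Its mass
  lies between two multiples of the mass of the cell, which suffices for either sign of
  \<open>q\<close>.\<close>

lemma moment_sum_lower:
  obtains c0 t0 where "c0 > 0" "t0 > 0" "\<And>t. 0 < t \<Longrightarrow> t < t0 \<Longrightarrow> c0 * t powr crit q \<le> moment_sum \<mu> q t"
proof -
  obtain c D where c: "c > 0" "D > 0"
    "\<And>v. good v \<Longrightarrow> c * (prob (cell v) powr q * scale v powr (- crit q)) \<le> energy q v"
    "\<And>v. good v \<Longrightarrow> energy q v \<le> D * (prob (cell v) powr q * scale v powr (- crit q))"
    using energy_comparable[of q] by metis
  have "emeasure \<mu> {0<..<\<beta>} > 0" 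
    unfolding emeasure_eq_measure prob_\<beta> ennreal_less_zero_iff using p_pos by simp
  then obtain x0 where x0: "x0 \<in> {0<..<\<beta>}" "x0 \<in> msupport \<mu>"
    using msupport_meets_open[OF sets_eq, of "{0<..<\<beta>}"] by auto
  \<comment> \<open>Half the distance of \<open>x0\<close> to the ends of
    \<open>{0<..<\<beta>}\<close>, an interval contained in the core of every node.\<close>
  define d where "d = min x0 (\<beta> - x0) / 2"
  have d: "d > 0" "d < 1" using x0 \<beta> by (auto simp: d_def)
  define E where "E = ball x0 (m * d)"
  have "m * d \<le> 1 * d" using m d by (intro mult_right_mono) auto
  then have E: "E \<subseteq> {0<..<\<beta>}" unfolding E_def ball_eq_greaterThanLessThan d_def by auto
  define \<eta> where "\<eta> = prob E / (1 + \<kappa>)"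
  have "prob E > 0" unfolding E_def using m d by (intro prob_open_pos[OF x0(2)]) auto
  then have \<eta>: "\<eta> > 0" using \<kappa>_pos by (simp add: \<eta>_def)
  define s0 where "s0 = min (m powr crit q) 1"
  have s0: "s0 > 0" using m by (auto simp: s0_def)
  define e0 where "e0 = min (\<eta> powr q) 1"
  have e0: "e0 > 0" using \<eta> by (auto simp: e0_def)
  define k where "k = 1 / (m * d)"
  have k: "k > 0" unfolding k_def using m d by (intro divide_pos_pos mult_pos_pos) auto
  define c0 where "c0 = e0 * s0 * k powr crit q / D"
  show ?thesis
  proof (rule that[of c0 "m * d"])
    show "c0 > 0" using e0 s0 k c(2) by (simp add: c0_def)
    show "m * d > 0" using m d by (intro mult_pos_pos)
    fix t assume t: "0 < t" "t < m * d"
    \<comment> \<open>At this scale \<open>t = m * T * d \<le> scale v * d\<close> and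
      \<open>scale v * (m * d) \<le> t\<close>: the ball of radius \<open>t\<close> about the image
      of \<open>x0\<close> fits into the cell and contains the image of \<open>E\<close>.\<close>
    define T where "T = t / (m * d)"
    have T: "0 < T" "T < 1" "T * (m * d) = t" using t m d by (auto simp: T_def)
    obtain C where C: "cut T root C" using ex_root_cut[OF T(1,2)] by blast
    have finC: "finite C" using C by (simp add: cut_def)
    define z where "z v = aff (offset v) (scale v) x0" for v
    have z_cball: "cball (z v) t \<subseteq> cell v" "aff (offset v) (scale v) ` E \<subseteq> cball (z v) t" if v: "v \<in> C" for v
    proof -
      note g = cutD[OF C v]
      have s: "scale v > 0" by (rule good_scale[OF g(1)])
      have "t \<le> scale v * d" using g(2) d T(3) mult_right_mono[of "m * T" "scale v" d] by (simp add: mult_ac)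
      moreover have "scale v * d < scale v * x0" "scale v * d < scale v * (\<beta> - x0)"
        using s x0(1) by (auto simp: d_def intro!: mult_strict_left_mono)
      ultimately have "t < scale v * x0" "scale v * x0 + t < \<beta> * scale v"
        by (simp_all add: right_diff_distrib mult.commute)
      then show "cball (z v) t \<subseteq> cell v"
        using width(1)[OF g(1)] unfolding cell_eq[OF g(1)] cball_eq_atLeastAtMost z_def aff_def
        by (intro subsetI) auto
      show "aff (offset v) (scale v) ` E \<subseteq> cball (z v) t"
      proof clarify
        fix y assume "y \<in> E"
        then have "\<bar>x0 - y\<bar> \<le> m * d" by (simp add: E_def dist_real_def)
        then have "scale v * \<bar>x0 - y\<bar> \<le> T * (m * d)"
          using g(3) s T(1) by (intro mult_mono) auto
        moreover have "dist (z v) (aff (offset v) (scale v) y) = scale v * \<bar>x0 - y\<bar>"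
          using s by (simp add: z_def aff_def dist_real_def abs_mult flip: right_diff_distrib)
        ultimately show "aff (offset v) (scale v) y \<in> cball (z v) t" using T(3) by simp
      qed
    qed
    have z_in: "z v \<in> cell v" if "v \<in> C" for v
      using z_cball(1)[OF that] t(1) by auto
    have disj: "cell a \<inter> cell b = {}" if "a \<in> C" "b \<in> C" "a \<noteq> b" for a b
      using C that by (auto simp: cut_def disjoint_family_on_def)
    have inj: "inj_on z C"
    proof (rule inj_onI, rule ccontr)
      fix a b assume ab: "a \<in> C" "b \<in> C" "z a = z b" "a \<noteq> b"
      then have "z a \<in> cell a \<inter> cell b" using z_in[OF ab(1)] z_in[OF ab(2)] by simp
      then show False using disj[OF ab(1,2,4)] by simp
    qed
    \<comment> \<open>A neighbourhood of the image of \<open>x0\<close> pulls back to one of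
      \<open>x0\<close>, whose mass is positive; \<open>prob_aff_lower\<close> carries positivity
      over.\<close>
    have z_supp: "z v \<in> msupport \<mu>" if v: "v \<in> C" for v
      unfolding msupport_def mem_Collect_eq
    proof (intro allI impI)
      fix U :: "real set" assume U: "open U" "z v \<in> U"
      note g = cutD[OF C v]
      define V where "V = aff (offset v) (scale v) -` U \<inter> {0<..<\<beta>}"
      have "open (aff (offset v) (scale v) -` U)"
        using U(1) unfolding aff_def[abs_def] by (intro open_vimage continuous_intros)
      then have V: "open V" "V \<subseteq> {0<..<\<beta>}" by (auto simp: V_def)
      have "x0 \<in> V" using U(2) x0(1) by (auto simp: V_def z_def)
      then have "0 < prob V" using V(1) by (intro prob_open_pos[OF x0(2)])
      then have "0 < prob (cell v) * prob V / (1 + \<kappa>)"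
        using prob_cell_pos[OF g(1)] \<kappa>_pos by simp
      also have "\<dots> \<le> prob (aff (offset v) (scale v) ` V)"
        using V by (intro prob_aff_lower g) auto
      also have "\<dots> \<le> prob U"
        using U(1) by (intro finite_measure_mono) (auto simp: V_def)
      finally show "emeasure \<mu> U > 0" by (simp add: emeasure_eq_measure)
    qed
    have packing: "z ` C \<in> packings \<mu> t"
      unfolding packings_def mem_Collect_eq disjoint_family_on_def
    proof (intro conjI ballI impI)
      fix x y assume "x \<in> z ` C" "y \<in> z ` C" "x \<noteq> y"
      then obtain a b where ab: "a \<in> C" "b \<in> C" "a \<noteq> b" "x = z a" "y = z b" by blast
      have "cball x t \<inter> cball y t \<subseteq> cell a \<inter> cell b"
        unfolding ab(4,5) by (intro Int_mono z_cball(1) ab)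
      then show "cball x t \<inter> cball y t = {}" using disj[OF ab(1-3)] by simp
    qed (use finC z_supp in auto)
    have cell_ge: "energy q v * (c0 * t powr crit q) \<le> prob (cball (z v) t) powr q" if v: "v \<in> C" for v
    proof -
      note g = cutD[OF C v]
      have s: "scale v > 0" by (rule good_scale[OF g(1)])
      have P: "prob (cell v) > 0" by (rule prob_cell_pos[OF g(1)])
      have "\<eta> * prob (cell v) = prob (cell v) * prob E / (1 + \<kappa>)" by (simp add: \<eta>_def)
      also have "\<dots> \<le> prob (aff (offset v) (scale v) ` E)"
        using E by (intro prob_aff_lower g) (auto simp: E_def)
      also have "\<dots> \<le> prob (cball (z v) t)" using z_cball(2)[OF v] by (intro finite_measure_mono) auto
      finally have lo: "\<eta> * prob (cell v) \<le> prob (cball (z v) t)" .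
      have hi: "prob (cball (z v) t) \<le> prob (cell v)"
        using z_cball(1)[OF v] g(1) by (intro finite_measure_mono) (auto simp: cell_borel)
      have ball: "e0 * prob (cell v) powr q \<le> prob (cball (z v) t) powr q"
        unfolding e0_def using powr_scale_between(1)[OF \<eta> P lo hi] .
      have Ts: "s0 * T powr crit q \<le> scale v powr crit q"
        unfolding s0_def using powr_scale_between(1)[OF m(1) T(1) g(2,3)] .
      have en: "0 \<le> energy q v"
      proof -
        have "0 \<le> c * (prob (cell v) powr q * scale v powr (- crit q))" using c(1) by simp
        then show ?thesis using c(3)[OF g(1)] by linarith
      qed
      have "T powr crit q = t powr crit q * k powr crit q"
        unfolding T_def k_def using t by (simp flip: powr_mult)
      then have "energy q v * (c0 * t powr crit q) = e0 * (energy q v / D * (s0 * T powr crit q))"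
        by (simp add: c0_def)
      also have "\<dots> \<le> e0 * (energy q v / D * scale v powr crit q)"
        using Ts e0 en c(2) by (intro mult_left_mono) auto
      also have "\<dots> \<le> e0 * (prob (cell v) powr q * scale v powr (- crit q) * scale v powr crit q)"
        using c(4)[OF g(1)] c(2) e0 by (intro mult_left_mono mult_right_mono) (auto simp: field_simps)
      also have "\<dots> = e0 * prob (cell v) powr q"
        using s by (simp add: mult.assoc flip: powr_add)
      finally show ?thesis using ball by linarith
    qed
    have "c0 * t powr crit q = (\<Sum>v\<in>C. energy q v) * (c0 * t powr crit q)"
      using C root(4)[of q] by (simp add: cut_def)
    also have "\<dots> = (\<Sum>v\<in>C. energy q v * (c0 * t powr crit q))" by (rule sum_distrib_right)
    also have "\<dots> \<le> (\<Sum>v\<in>C. prob (cball (z v) t) powr q)" using cell_ge by (intro sum_mono)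
    also have "\<dots> = (\<Sum>x\<in>z ` C. prob (cball x t) powr q)" by (simp add: sum.reindex[OF inj])
    also have "\<dots> \<le> moment_sum \<mu> q t"
      unfolding moment_sum_def using packing t(1)
      by (intro cSUP_upper bdd_above_moment_sums compact_msupport finite_measure_axioms sets_eq)
    finally show "c0 * t powr crit q \<le> moment_sum \<mu> q t" .
  qed
qed

lemma Lq_spectrum_eq_crit: "Lq_spectrum \<mu> q = ereal (crit q)"
proof -
  obtain C0 where C0: "C0 > 0" "\<And>t. 0 < t \<Longrightarrow> t < 1 \<Longrightarrow> moment_sum \<mu> q t \<le> C0 * t powr crit q"
    using moment_sum_upper[of q] by metis
  obtain c0 t0 where c0: "c0 > 0" "t0 > 0"
    "\<And>t. 0 < t \<Longrightarrow> t < t0 \<Longrightarrow> c0 * t powr crit q \<le> moment_sum \<mu> q t"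
    using moment_sum_lower[of q] by metis
  have "((\<lambda>t. ln (moment_sum \<mu> q t) / ln t) \<longlongrightarrow> crit q) (at_right 0)"
    by (rule tendsto_ln_ratio[where ?t0.0 = "min 1 t0", OF c0(1) C0(1)]) (use C0 c0 in auto)
  then have "((\<lambda>t. ereal (ln (moment_sum \<mu> q t) / ln t)) \<longlongrightarrow> ereal (crit q)) (at_right 0)"
    by (rule tendsto_ereal)
  then show ?thesis
    unfolding Lq_spectrum_def by (intro lim_imp_Liminf) auto
qed

end

theorem corollary1p6:
  fixes \<rho> r :: real and S :: "nat \<Rightarrow> real \<Rightarrow> real" and p :: "nat \<Rightarrow> real" and \<mu> :: "real measure"
  assumes "0 < \<rho>" "\<rho> < 1" and "0 < r" "r < 1"
    and "\<rho> + 2 * r - \<rho> * r \<le> 1"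
    and "S 1 = (\<lambda>x. \<rho> * x)"
    and "S 2 = (\<lambda>x. r * x + \<rho> * (1 - r))"
    and "S 3 = (\<lambda>x. r * x + 1 - r)"
    and "p 1 > 0" "p 2 > 0" "p 3 > 0" and "p 1 + p 2 + p 3 = 1"
    and "self_similar_measure {1, 2, 3} S p \<mu>"
    and "p 2 > p 3"
  shows "\<exists>\<tau>. (\<forall>q. Lq_spectrum \<mu> q = ereal (\<tau> q)) \<and> (\<forall>q. \<tau> differentiable (at q))"
proof -
  note self_sim = assms(13)[unfolded self_similar_measure_def]
  have S: "S 1 = aff 0 \<rho>" "S 2 = aff (\<rho> * (1 - r)) r" "S 3 = aff (1 - r) r"
    using assms(6-8) by (auto simp: aff_def fun_eq_iff)
  interpret prob_space \<mu> using self_sim by blast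
  interpret overlap_measure \<rho> r "p 1" "p 2" "p 3" \<mu>
  proof unfold_locales
    fix E :: "real set" assume "E \<in> sets borel"
    then have "prob E = (\<Sum>i\<in>{1, 2, 3}. p i * prob (S i -` E))" using self_sim by blast
    also have "\<dots> = p 1 * prob (S 1 -` E) + p 2 * prob (S 2 -` E) + p 3 * prob (S 3 -` E)" by simp
    finally show "prob E = p 1 * prob (aff 0 \<rho> -` E) + p 2 * prob (aff (\<rho> * (1 - r)) r -` E)
        + p 3 * prob (aff (1 - r) r -` E)"
      by (simp only: S)
  qed (use assms self_sim in auto)
  show ?thesis
    using Lq_spectrum_eq_crit crit_differentiable by blast
qed

end
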